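(* Let $(\mathcal Q,\mathscr L)$ be a Lagrangian system with regular Lagrangian and initial value $(q_0,v_0)\in T\mathcal Q$, let $\varphi_{\mathcal Q}\in C^\infty(\check{\mathcal Q},\mathcal Q)$ be a smooth embedding with point reduction $\varrho_{\mathcal Q}\in C^\infty(\mathcal Q,\check{\mathcal Q})$, let $\varphi=\mathrm d\varphi_{\mathcal Q}$ and $\varrho=\mathrm d\varrho_{\mathcal Q}$ be the lifted embedding and lifted point reduction, and assume that the reduced Lagrangian $\check{\mathscr L}=\mathscr L\circ\varphi$ is regular and that the reduced tensor field $\check\tau_{\mathrm{LMG}}=\varphi^*\tau_{\mathrm{LMG}}$ is nondegenerate. Consider the reduced-order model (ROM) obtained by reducing the Euler–Lagrangian vector field $X_{\mathscr L}$ with the Lagrangian manifold Galerkin reduction map $R_{\mathrm{LMG}}$, i.e. the initial value problem for $\check\gamma\in C^\infty(\mathcal I,T\check{\mathcal Q})$ $$\tfrac{\mathrm d}{\mathrm dt}\check\gamma\big|_t=R_{\mathrm{LMG}}|_{\varphi(\check\gamma(t))}\big(X_{\mathscr L}|_{\varphi(\check\gamma(t))}\big),\qquad \check\gamma(t_0)=\varrho(q_0,v_0).$$ Then solving this ROM for $\check\gamma$ is equivalent to solving the reduced Euler–Lagrange equations (the Euler–Lagrange equations of $(\check{\mathcal Q},\check{\mathscr L})$ with initial value $\varrho(q_0,v_0)$) for $\check\gamma_{\mathcal Q}\in C^\infty(\mathcal I,\check{\mathcal Q})$, with $\check\gamma(t)=\Gamma_{\check\gamma_{\mathcal Q}}(t)$.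 That is, if $\check\gamma_{\mathcal Q}$ solves the reduced Euler–Lagrange equations then $\check\gamma=\Gamma_{\check\gamma_{\mathcal Q}}$ solves the ROM, and every solution $\check\gamma$ of the ROM is of the form $\Gamma_{\check\gamma_{\mathcal Q}}$ with $\check\gamma_{\mathcal Q}$ a solution of the reduced Euler–Lagrange equations.
   Context: $\mathcal Q$ and $\check{\mathcal Q}$ are smooth manifolds of dimensions $Q$ and $\check Q$; $\mathcal I=(t_0,t_{\mathrm f})$ is a time interval (values at $t_0$ are understood by continuous extension). Fix charts $(V,y)$ of $\mathcal Q$ and $(\check V,\check y)$ of $\check{\mathcal Q}$ with $\varphi_{\mathcal Q}(\check V)\subseteq V$; all coordinate expressions below are with respect to these charts and the induced natural charts $(TV,\xi)$, $(T\check V,\check\xi)$ of the tangent bundles, and points and curves are taken in these chart domains. Here for $Y=(q,v)\in TV$ with $v=\sum_i v^i\partial/\partial y^i|_q$ one has $\xi^i(Y)=y^i(q)$, $\xi^{Q+i}(Y)=v^i$ for $1\le i\le Q$ (analogously $\check\xi$ with $\check Q$). Repeated indices are summed. Lift of a curve: $\Gamma_{\gamma_{\mathcal Q}}(t)=\big(\gamma_{\mathcal Q}(t),\tfrac{\mathrm d}{\mathrm dt}\gamma_{\mathcal Q}|_t\big)$. A Lagrangian system $(\mathcal Q,\mathscr L)$ consists of $\mathcal Q$ and $\mathscr L\in C^\infty(T\mathcal Q,\mathbb R)$. Its Euler–Lagrange equations with initial value $(q_0,v_0)\in T\mathcal Q$ are, for $\gamma_{\mathcal Q}\in C^\infty(\mathcal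 I,\mathcal Q)$ and $1\le i\le Q$, $$\frac{\partial\mathscr L}{\partial\xi^i}\Big|_{\Gamma_{\gamma_{\mathcal Q}}(t)}-\frac{\mathrm d}{\mathrm dt}\Big(\frac{\partial\mathscr L}{\partial\xi^{Q+i}}\Big|_{\Gamma_{\gamma_{\mathcal Q}}(\cdot)}\Big)\Big|_t=0,\qquad \Gamma_{\gamma_{\mathcal Q}}(t_0)=(q_0,v_0).$$ $\mathscr L$ is regular if the matrix $(\tau_v|_Y)_{ij}:=\frac{\partial^2\mathscr L}{\partial\xi^{Q+i}\partial\xi^{Q+j}}\big|_Y$, $1\le i,j\le Q$, is invertible at each $Y$; write $(\tau_v|_Y)^{ij}$ for its inverse. The Euler–Lagrangian vector field is, at $Y=(q,v^i\partial/\partial y^i|_q)$, $$X_{\mathscr L}|_Y=v^i\frac{\partial}{\partial\xi^i}\Big|_Y+(\tau_v|_Y)^{ij}\Big(\frac{\partial\mathscr L}{\partial\xi^j}\Big|_Y-\frac{\partial^2\mathscr L}{\partial\xi^k\,\partial\xi^{Q+j}}\Big|_Y v^k\Big)\frac{\partial}{\partial\xi^{Q+i}}\Big|_Y .$$ A smooth embedding is a smooth immersion that is a homeomorphism onto its image; a point reduction $\varrho_{\mathcal Q}$ for $\varphi_{\mathcal Q}$ satisfies $\varrho_{\mathcal Q}\circ\varphi_{\mathcal Q}=\mathrm{id}_{\check{\mathcal Q}}$. Lifted embedding: $\varphi:=\mathrm d\varphi_{\mathcal Q}:T\check{\mathcal Q}\to T\mathcal Q$, $(\check q,\check v)\mapsto(\varphi_{\mathcal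 Q}(\check q),\mathrm d\varphi_{\mathcal Q}|_{\check q}(\check v))$. Lifted point reduction: $\varrho:=\mathrm d\varrho_{\mathcal Q}:T\mathcal Q\to T\check{\mathcal Q}$, $(q,v)\mapsto(\varrho_{\mathcal Q}(q),\mathrm d\varrho_{\mathcal Q}|_q(v))$. The reduced Lagrangian is $\check{\mathscr L}:=\mathscr L\circ\varphi$. LMG tensor field on $\mathcal M:=T\mathcal Q$: the nondegenerate $(0,2)$-tensor field $$\tau_{\mathrm{LMG}}|_Y=(\tau_q|_Y)_{ij}\,\mathrm d\xi^{Q+i}|_Y\otimes\mathrm d\xi^{j}|_Y+(\tau_v|_Y)_{ij}\,\mathrm d\xi^{i}|_Y\otimes\mathrm d\xi^{Q+j}|_Y,$$ where $(\tau_q)_{ij}$, $1\le i,j\le Q$, are additional smooth component functions (a typical choice being $\tau_q=\tau_v$). The reduced tensor field is the pullback $\check\tau_{\mathrm{LMG}}:=\varphi^*\tau_{\mathrm{LMG}}$ on $\check{\mathcal M}:=T\check{\mathcal Q}$. LMG reduction map: for $m\in\varphi(\check{\mathcal M})$ and $w\in T_m\mathcal M$, $$R_{\mathrm{LMG}}(m,w)=\Big(\varrho(m),R_{\mathrm{LMG}}|_m(w)\Big),\qquad R_{\mathrm{LMG}}|_m(w)=\big(\sharp_{\check\tau_{\mathrm{LMG}}}\circ\mathrm d\varphi^*|_{\varrho(m)}\circ\flat_{\tau_{\mathrm{LMG}}}\big)(w).$$ Here, for a nondegenerate $(0,2)$-tensor field $\tau$, $\flat_\tau$ maps a tangent vector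 $w$ to the covector with components $(\flat_\tau w)_\alpha=\tau_{\alpha\beta}w^\beta$, $\sharp_\tau$ is the inverse of $\flat_\tau$, and $\mathrm d\varphi^*|_{\check m}:T^*_{\varphi(\check m)}\mathcal M\to T^*_{\check m}\check{\mathcal M}$ is $\lambda\mapsto\lambda\circ\mathrm d\varphi|_{\check m}$. *)

theory Defs
  imports "HOL-Analysis.Analysis"
begin

section \<open>Smooth manifolds\<close>

primrec k_times_differentiable_on ::
  "nat \<Rightarrow> ('a::real_normed_vector \<Rightarrow> 'b::real_normed_vector) \<Rightarrow> 'a set \<Rightarrow> bool" where
  "k_times_differentiable_on 0 f S \<longleftrightarrow> continuous_on S f"
| "k_times_differentiable_on (Suc k) f S \<longleftrightarrow>
     (\<forall>x\<in>S. f differentiable (at x)) \<and>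
     (\<forall>h. k_times_differentiable_on k (\<lambda>x. frechet_derivative f (at x) h) S)"

text \<open>Smoothness; only used for open \<open>S\<close> in finite dimension.\<close>

definition smooth_on :: "('a::real_normed_vector \<Rightarrow> 'b::real_normed_vector) \<Rightarrow> 'a set \<Rightarrow> bool" where
  "smooth_on f S \<longleftrightarrow> (\<forall>k. k_times_differentiable_on k f S)"

text \<open>A chart is a domain together with a coordinate map (irrelevant outside the domain).\<close>

type_synonym ('a, 'e) chart = "'a set \<times> ('a \<Rightarrow> 'e)"

definition chart_inv :: "('a, 'e) chart \<Rightarrow> 'e \<Rightarrow> 'a" where
  "chart_inv c = inv_into (fst c) (snd c)"

record ('a, 'e) mfd =
  mtop :: "'a topology"
  atlas :: "('a, 'e) chart set"

text \<open>
  The atlas is not required to be maximal. Maximal atlases are included, and an arbitrary chart of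
  the smooth structure may always be taken to be a member of the atlas.
\<close>

definition smooth_manifold :: "('a, 'e::euclidean_space) mfd \<Rightarrow> bool" where
  "smooth_manifold M \<longleftrightarrow>
     Hausdorff_space (mtop M) \<and> second_countable (mtop M) \<and>
     (\<Union>c\<in>atlas M. fst c) = topspace (mtop M) \<and>
     (\<forall>c\<in>atlas M. openin (mtop M) (fst c) \<and> open (snd c ` fst c) \<and>
        homeomorphic_map (subtopology (mtop M) (fst c)) (top_of_set (snd c ` fst c)) (snd c)) \<and>
     (\<forall>c\<in>atlas M. \<forall>d\<in>atlas M. smooth_on (snd d \<circ> chart_inv c) (snd c ` (fst c \<inter> fst d)))"

definition charts_at :: "('a, 'e) mfd \<Rightarrow> 'a \<Rightarrow> ('a, 'e) chart set" where
  "charts_at M p = {c \<in> atlas M. p \<in> fst c}"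

text \<open>An open subset of a Euclidean space as a manifold with one global chart.\<close>

definition open_mfd :: "'e::euclidean_space set \<Rightarrow> ('e, 'e) mfd" where
  "open_mfd S = \<lparr>mtop = top_of_set S, atlas = {(S, id)}\<rparr>"

definition smooth_map ::
  "('a, 'e::euclidean_space) mfd \<Rightarrow> ('b, 'f::euclidean_space) mfd \<Rightarrow> ('a \<Rightarrow> 'b) \<Rightarrow> bool" where
  "smooth_map M N f \<longleftrightarrow>
     continuous_map (mtop M) (mtop N) f \<and>
     (\<forall>c\<in>atlas M. \<forall>d\<in>atlas N.
        smooth_on (snd d \<circ> f \<circ> chart_inv c) (snd c ` {p \<in> fst c. f p \<in> fst d}))"

section \<open>Tangent vectors, differentials, tangent bundle\<close>

text \<open>
  A tangent vector at \<open>p\<close> is the family of its component vectors in all charts around \<open>p\<close>, related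
  by the derivatives of the transition maps (and \<open>0\<close> by convention at all other charts).
  Thus \<open>v c\<close> are the components of \<open>v\<close> with respect to the chart \<open>c\<close>.
\<close>

type_synonym ('a, 'e) tvec = "('a, 'e) chart \<Rightarrow> 'e"

definition tangent_space :: "('a, 'e::euclidean_space) mfd \<Rightarrow> 'a \<Rightarrow> ('a, 'e) tvec set" where
  "tangent_space M p =
     {v. (\<forall>c\<in>charts_at M p. \<forall>d\<in>charts_at M p.
            v d = frechet_derivative (snd d \<circ> chart_inv c) (at (snd c p)) (v c)) \<and>
         (\<forall>c. c \<notin> charts_at M p \<longrightarrow> v c = 0)}"

text \<open>The tangent vector at \<open>p\<close> with components \<open>x\<close> in the chart \<open>c\<close>.\<close>

definition tvec_of_coords ::
  "('a, 'e::euclidean_space) mfd \<Rightarrow> ('a, 'e) chart \<Rightarrow> 'a \<Rightarrow> 'e \<Rightarrow> ('a, 'e) tvec" where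
  "tvec_of_coords M c p x =
     (\<lambda>d. if d \<in> charts_at M p
          then frechet_derivative (snd d \<circ> chart_inv c) (at (snd c p)) x else 0)"

text \<open>By the chain rule the choice of the chart \<open>c\<close> is immaterial for \<open>v \<in> tangent_space M p\<close>.\<close>

definition differential ::
  "('a, 'e::euclidean_space) mfd \<Rightarrow> ('b, 'f::euclidean_space) mfd \<Rightarrow> ('a \<Rightarrow> 'b) \<Rightarrow> 'a
     \<Rightarrow> ('a, 'e) tvec \<Rightarrow> ('b, 'f) tvec" where
  "differential M N f p v =
     (let c = (SOME c. c \<in> charts_at M p) in
      (\<lambda>d. if d \<in> charts_at N (f p)
           then frechet_derivative (snd d \<circ> f \<circ> chart_inv c) (at (snd c p)) (v c) else 0))"

definition velocity :: "('a, 'e::euclidean_space) mfd \<Rightarrow> (real \<Rightarrow> 'a) \<Rightarrow> real \<Rightarrow> ('a, 'e) tvec" where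
  "velocity M \<gamma> t =
     (\<lambda>c. if c \<in> charts_at M (\<gamma> t) then vector_derivative (snd c \<circ> \<gamma>) (at t) else 0)"

text \<open>The first component of a pair carries \<open>\<xi>\<^sup>i = y\<^sup>i\<close>, the second carries \<open>\<xi>\<close> with index \<open>Q + i\<close>.\<close>

definition natural_chart ::
  "('a, 'e::euclidean_space) mfd \<Rightarrow> ('a, 'e) chart \<Rightarrow> ('a \<times> ('a, 'e) tvec, 'e \<times> 'e) chart" where
  "natural_chart M c =
     ({(q, v). q \<in> fst c \<and> v \<in> tangent_space M q}, (\<lambda>(q, v). (snd c q, v c)))"

definition tangent_bundle ::
  "('a, 'e::euclidean_space) mfd \<Rightarrow> ('a \<times> ('a, 'e) tvec, 'e \<times> 'e) mfd" where
  "tangent_bundle M =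
     \<lparr>mtop = topology_generated_by
        {{Y \<in> fst (natural_chart M c). snd (natural_chart M c) Y \<in> W} | c W. c \<in> atlas M \<and> open W},
      atlas = natural_chart M ` atlas M\<rparr>"

definition tangent_map ::
  "('a, 'e::euclidean_space) mfd \<Rightarrow> ('b, 'f::euclidean_space) mfd \<Rightarrow> ('a \<Rightarrow> 'b)
     \<Rightarrow> 'a \<times> ('a, 'e) tvec \<Rightarrow> 'b \<times> ('b, 'f) tvec" where
  "tangent_map M N f = (\<lambda>(q, v). (f q, differential M N f q v))"

definition curve_lift ::
  "('a, 'e::euclidean_space) mfd \<Rightarrow> (real \<Rightarrow> 'a) \<Rightarrow> real \<Rightarrow> 'a \<times> ('a, 'e) tvec" where
  "curve_lift M \<gamma> t = (\<gamma> t, velocity M \<gamma> t)"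

definition smooth_embedding ::
  "('a, 'e::euclidean_space) mfd \<Rightarrow> ('b, 'f::euclidean_space) mfd \<Rightarrow> ('a \<Rightarrow> 'b) \<Rightarrow> bool" where
  "smooth_embedding M N f \<longleftrightarrow>
     smooth_map M N f \<and>
     (\<forall>p\<in>topspace (mtop M). inj_on (differential M N f p) (tangent_space M p)) \<and>
     embedding_map (mtop M) (mtop N) f"

definition point_reduction ::
  "('a, 'e::euclidean_space) mfd \<Rightarrow> ('b, 'f::euclidean_space) mfd \<Rightarrow> ('a \<Rightarrow> 'b) \<Rightarrow> ('b \<Rightarrow> 'a) \<Rightarrow> bool"
  where
  "point_reduction M N \<phi> \<rho> \<longleftrightarrow> smooth_map N M \<rho> \<and> (\<forall>p\<in>topspace (mtop M). \<rho> (\<phi> p) = p)"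

section \<open>Lagrangian systems\<close>

text \<open>
  Partial derivative at \<open>p\<close> of a real function on the manifold, in the chart \<open>c\<close> and the coordinate
  direction \<open>b\<close>. All functions it is applied to are smooth.
\<close>

definition chart_partial ::
  "('a, 'e::euclidean_space) chart \<Rightarrow> 'e \<Rightarrow> ('a \<Rightarrow> real) \<Rightarrow> 'a \<Rightarrow> real" where
  "chart_partial c b f p = frechet_derivative (f \<circ> chart_inv c) (at (snd c p)) b"

definition pos_partial ::
  "('a, real^'n) mfd \<Rightarrow> ('a, real^'n) chart \<Rightarrow> 'n
     \<Rightarrow> ('a \<times> ('a, real^'n) tvec \<Rightarrow> real) \<Rightarrow> 'a \<times> ('a, real^'n) tvec \<Rightarrow> real" where
  "pos_partial M c i = chart_partial (natural_chart M c) (axis i 1, 0)"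

definition vel_partial ::
  "('a, real^'n) mfd \<Rightarrow> ('a, real^'n) chart \<Rightarrow> 'n
     \<Rightarrow> ('a \<times> ('a, real^'n) tvec \<Rightarrow> real) \<Rightarrow> 'a \<times> ('a, real^'n) tvec \<Rightarrow> real" where
  "vel_partial M c i = chart_partial (natural_chart M c) (0, axis i 1)"

definition lagrangian :: "('a, real^'n) mfd \<Rightarrow> ('a \<times> ('a, real^'n) tvec \<Rightarrow> real) \<Rightarrow> bool" where
  "lagrangian M L \<longleftrightarrow> smooth_map (tangent_bundle M) (open_mfd UNIV) L"

definition vel_hessian ::
  "('a, real^'n) mfd \<Rightarrow> ('a, real^'n) chart \<Rightarrow> ('a \<times> ('a, real^'n) tvec \<Rightarrow> real)
     \<Rightarrow> 'a \<times> ('a, real^'n) tvec \<Rightarrow> real^'n^'n" where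
  "vel_hessian M c L Y = (\<chi> i j. vel_partial M c i (vel_partial M c j L) Y)"

definition regular_lagrangian ::
  "('a, real^'n) mfd \<Rightarrow> ('a, real^'n) chart \<Rightarrow> ('a \<times> ('a, real^'n) tvec \<Rightarrow> real) \<Rightarrow> bool" where
  "regular_lagrangian M c L \<longleftrightarrow> (\<forall>Y\<in>fst (natural_chart M c). invertible (vel_hessian M c L Y))"

definition EL_vector_field ::
  "('a, real^'n) mfd \<Rightarrow> ('a, real^'n) chart \<Rightarrow> ('a \<times> ('a, real^'n) tvec \<Rightarrow> real)
     \<Rightarrow> 'a \<times> ('a, real^'n) tvec
     \<Rightarrow> ('a \<times> ('a, real^'n) tvec, (real^'n) \<times> (real^'n)) tvec" where
  "EL_vector_field M c L Y =
     (let v = snd Y c in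
      tvec_of_coords (tangent_bundle M) (natural_chart M c) Y
        (v, matrix_inv (vel_hessian M c L Y) *v
              (\<chi> j. pos_partial M c j L Y
                    - (\<Sum>k\<in>UNIV. pos_partial M c k (vel_partial M c j L) Y * v $ k))))"

text \<open>
  Solutions on \<open>(t0, tf)\<close> with values in the domain of the chart \<open>c\<close>; the initial value at \<open>t0\<close> is
  attained by continuous extension, i.e. as a limit in the tangent bundle.
\<close>

definition solves_euler_lagrange ::
  "('a, real^'n) mfd \<Rightarrow> ('a, real^'n) chart \<Rightarrow> ('a \<times> ('a, real^'n) tvec \<Rightarrow> real)
     \<Rightarrow> real \<Rightarrow> real \<Rightarrow> 'a \<times> ('a, real^'n) tvec \<Rightarrow> (real \<Rightarrow> 'a) \<Rightarrow> bool" where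
  "solves_euler_lagrange M c L t0 tf Y0 \<gamma> \<longleftrightarrow>
     smooth_map (open_mfd {t0<..<tf}) M \<gamma> \<and> \<gamma> ` {t0<..<tf} \<subseteq> fst c \<and>
     (\<forall>t\<in>{t0<..<tf}. \<forall>i.
        pos_partial M c i L (curve_lift M \<gamma> t)
        - deriv (\<lambda>s. vel_partial M c i L (curve_lift M \<gamma> s)) t = 0) \<and>
     limitin (mtop (tangent_bundle M)) (curve_lift M \<gamma>) Y0 (at_right t0)"

definition solves_ivp ::
  "('a, 'e::euclidean_space) mfd \<Rightarrow> 'a set \<Rightarrow> ('a \<Rightarrow> ('a, 'e) tvec)
     \<Rightarrow> real \<Rightarrow> real \<Rightarrow> 'a \<Rightarrow> (real \<Rightarrow> 'a) \<Rightarrow> bool" where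
  "solves_ivp M D X t0 tf p0 \<gamma> \<longleftrightarrow>
     smooth_map (open_mfd {t0<..<tf}) M \<gamma> \<and> \<gamma> ` {t0<..<tf} \<subseteq> D \<and>
     (\<forall>t\<in>{t0<..<tf}. velocity M \<gamma> t = X (\<gamma> t)) \<and>
     limitin (mtop M) \<gamma> p0 (at_right t0)"

section \<open>(0,2)-tensor fields and the Lagrangian manifold Galerkin reduction\<close>

type_synonym ('a, 'e) tensor02 = "'a \<Rightarrow> ('a, 'e) tvec \<Rightarrow> ('a, 'e) tvec \<Rightarrow> real"

text \<open>Covectors at \<open>p\<close> are functions on the tangent space, \<open>undefined\<close> outside of it.\<close>

definition flat ::
  "('a, 'e::euclidean_space) mfd \<Rightarrow> ('a, 'e) tensor02 \<Rightarrow> 'a \<Rightarrow> ('a, 'e) tvec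
     \<Rightarrow> ('a, 'e) tvec \<Rightarrow> real" where
  "flat M \<tau> p w = restrict (\<lambda>u. \<tau> p u w) (tangent_space M p)"

definition sharp ::
  "('a, 'e::euclidean_space) mfd \<Rightarrow> ('a, 'e) tensor02 \<Rightarrow> 'a \<Rightarrow> (('a, 'e) tvec \<Rightarrow> real)
     \<Rightarrow> ('a, 'e) tvec" where
  "sharp M \<tau> p = inv_into (tangent_space M p) (flat M \<tau> p)"

definition nondegenerate_on ::
  "('a, 'e::euclidean_space) mfd \<Rightarrow> 'a set \<Rightarrow> ('a, 'e) tensor02 \<Rightarrow> bool" where
  "nondegenerate_on M D \<tau> \<longleftrightarrow>
     (\<forall>p\<in>D. \<forall>w\<in>tangent_space M p. (\<forall>u\<in>tangent_space M p. \<tau> p u w = 0) \<longrightarrow> w = (\<lambda>_. 0))"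

definition pullback_covector ::
  "('a, 'e::euclidean_space) mfd \<Rightarrow> ('b, 'f::euclidean_space) mfd \<Rightarrow> ('a \<Rightarrow> 'b) \<Rightarrow> 'a
     \<Rightarrow> (('b, 'f) tvec \<Rightarrow> real) \<Rightarrow> ('a, 'e) tvec \<Rightarrow> real" where
  "pullback_covector M N f p \<mu> = restrict (\<mu> \<circ> differential M N f p) (tangent_space M p)"

definition pullback_tensor ::
  "('a, 'e::euclidean_space) mfd \<Rightarrow> ('b, 'f::euclidean_space) mfd \<Rightarrow> ('a \<Rightarrow> 'b)
     \<Rightarrow> ('b, 'f) tensor02 \<Rightarrow> ('a, 'e) tensor02" where
  "pullback_tensor M N f \<tau> p u w =
     \<tau> (f p) (differential M N f p u) (differential M N f p w)"

text \<open>
  The LMG tensor field over the chart domain. For \<open>u\<close> tangent to the tangent bundle,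
  \<open>fst (u \<xi>) $ i\<close> and \<open>snd (u \<xi>) $ i\<close> are the values on \<open>u\<close> of the differentials of the \<open>i\<close>-th
  position and the \<open>i\<close>-th velocity coordinate.
\<close>

definition tau_LMG ::
  "('a, real^'n) mfd \<Rightarrow> ('a, real^'n) chart \<Rightarrow> ('a \<times> ('a, real^'n) tvec \<Rightarrow> real)
     \<Rightarrow> ('a \<times> ('a, real^'n) tvec \<Rightarrow> real^'n^'n)
     \<Rightarrow> ('a \<times> ('a, real^'n) tvec, (real^'n) \<times> (real^'n)) tensor02" where
  "tau_LMG M c L \<tau>q Y u w =
     (let \<xi> = natural_chart M c in
      (\<Sum>i\<in>UNIV. \<Sum>j\<in>UNIV. \<tau>q Y $ i $ j * snd (u \<xi>) $ i * fst (w \<xi>) $ j) +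
      (\<Sum>i\<in>UNIV. \<Sum>j\<in>UNIV. vel_hessian M c L Y $ i $ j * fst (u \<xi>) $ i * snd (w \<xi>) $ j))"

text \<open>
  Fibre part of the reduction map at \<open>m\<close> in the image of \<open>\<phi>\<close>; its values are tangent vectors at
  \<open>\<rho> m\<close>. Here \<open>M'\<close>, \<open>M\<close> are the reduced and the full state manifold.
\<close>

definition reduction_map_at ::
  "('b, 'f::euclidean_space) mfd \<Rightarrow> ('a, 'e::euclidean_space) mfd \<Rightarrow> ('b \<Rightarrow> 'a) \<Rightarrow> ('a \<Rightarrow> 'b)
     \<Rightarrow> ('a, 'e) tensor02 \<Rightarrow> 'a \<Rightarrow> ('a, 'e) tvec \<Rightarrow> ('b, 'f) tvec" where
  "reduction_map_at M' M \<phi> \<rho> \<tau> m =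
     sharp M' (pullback_tensor M' M \<phi> \<tau>) (\<rho> m)
       \<circ> pullback_covector M' M \<phi> (\<rho> m)
       \<circ> flat M \<tau> m"

definition R_LMG ::
  "('b, real^'m) mfd \<Rightarrow> ('a, real^'n) mfd \<Rightarrow> ('a, real^'n) chart
     \<Rightarrow> ('b \<Rightarrow> 'a) \<Rightarrow> ('a \<Rightarrow> 'b) \<Rightarrow> ('a \<times> ('a, real^'n) tvec \<Rightarrow> real)
     \<Rightarrow> ('a \<times> ('a, real^'n) tvec \<Rightarrow> real^'n^'n)
     \<Rightarrow> 'a \<times> ('a, real^'n) tvec
     \<Rightarrow> ('a \<times> ('a, real^'n) tvec, (real^'n) \<times> (real^'n)) tvec
     \<Rightarrow> ('b \<times> ('b, real^'m) tvec, (real^'m) \<times> (real^'m)) tvec" where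
  "R_LMG Q' Q c \<phi>Q \<rho>Q L \<tau>q =
     reduction_map_at (tangent_bundle Q') (tangent_bundle Q)
       (tangent_map Q' Q \<phi>Q) (tangent_map Q Q' \<rho>Q) (tau_LMG Q c L \<tau>q)"

definition solves_LMG_ROM ::
  "('b, real^'m) mfd \<Rightarrow> ('b, real^'m) chart \<Rightarrow> ('a, real^'n) mfd \<Rightarrow> ('a, real^'n) chart
     \<Rightarrow> ('b \<Rightarrow> 'a) \<Rightarrow> ('a \<Rightarrow> 'b) \<Rightarrow> ('a \<times> ('a, real^'n) tvec \<Rightarrow> real)
     \<Rightarrow> ('a \<times> ('a, real^'n) tvec \<Rightarrow> real^'n^'n)
     \<Rightarrow> real \<Rightarrow> real \<Rightarrow> 'a \<times> ('a, real^'n) tvec \<Rightarrow> (real \<Rightarrow> 'b \<times> ('b, real^'m) tvec) \<Rightarrow> bool" where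
  "solves_LMG_ROM Q' c' Q c \<phi>Q \<rho>Q L \<tau>q t0 tf Y0 \<gamma> \<longleftrightarrow>
     solves_ivp (tangent_bundle Q') (fst (natural_chart Q' c'))
       (\<lambda>m'. let m = tangent_map Q' Q \<phi>Q m' in
              R_LMG Q' Q c \<phi>Q \<rho>Q L \<tau>q m (EL_vector_field Q c L m))
       t0 tf (tangent_map Q Q' \<rho>Q Y0) \<gamma>"

end

theory Submission
  imports Defs
begin

text \<open>
  The reduction map turns the reduced vector field into the solution of a weak equation: applying
  \<open>\<flat>\<close> of the reduced tensor field to the defining equation of the reduced-order model shows that
  \<open>\<gamma>' = R (X)\<close> holds at a state \<open>Y\<close> of \<open>TQ'\<close> if and only if

    \<open>\<tau> (d\<phi> u) (d\<phi> \<gamma>') = \<tau> (d\<phi> u) X\<close> for all \<open>u\<close> tangent to \<open>TQ'\<close> at \<open>Y\<close>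

  (\<open>sharp_eq_iff\<close>). In natural charts write \<open>F\<close> for the point embedding, \<open>\<Lambda>\<close> for the Lagrangian,
  \<open>Y = (x, v)\<close> and \<open>\<gamma>' = (p, s)\<close>. The lifted embedding is \<open>(x, v) \<mapsto> (F x, DF v)\<close>, with differential
  \<open>(a, b) \<mapsto> (DF a, D\<^sup>2F (a, v) + DF b)\<close>, and \<open>X = (DF v, A)\<close>, where \<open>A\<close> is the acceleration at which
  the Euler--Lagrange expression of \<open>\<Lambda>\<close> vanishes.

  The tensor is block antidiagonal, so the weak equation is triangular. Tested with \<open>u = (0, b)\<close> it involves only
  the block \<open>\<tau>\<^sub>q\<close> and reads \<open>\<tau>\<^sub>q (DF b) (DF (p - v)) = 0\<close>; by nondegeneracy of the reduced tensor and
  regularity of the reduced Lagrangian this means \<open>p = v\<close>. So a solution of the reduced-order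
  model is the lift of its base curve. Tested with \<open>u = (a, 0)\<close>, and given \<open>p = v\<close>, it involves only
  the velocity Hessian and says that the Euler--Lagrange expression of \<open>\<Lambda>\<close> at acceleration
  \<open>D\<^sup>2F (v, v) + DF s\<close> vanishes on all \<open>DF a\<close> (\<open>Galerkin_equation_iff\<close>).

  The acceleration just named is the one of the image curve. The Euler--Lagrange expression is natural: pulling
  back the Lagrangian pulls back the expression (\<open>EL_residual_pullback\<close>). Hence the second condition is the
  Euler--Lagrange equation of the reduced Lagrangian. Naturality needs the symmetry of the
  second derivative of \<open>F\<close> (\<open>fderiv2_commute\<close>), and reading off \<open>A\<close> from the Euler--Lagrangian
  vector field needs it for \<open>\<Lambda>\<close>.

  The remaining lemmas transport this computation from coordinates to the manifolds: tangent vectors are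
  determined by their components in one chart, the tangent map of \<open>f\<close> has in natural charts the form
  \<open>tangent_fun\<close> of the coordinate expression of \<open>f\<close>, lifts of smooth curves are smooth, and the lifted
  point reduction maps \<open>\<phi> (Y)\<close> back to \<open>Y\<close>.
\<close>

section \<open>First and second derivatives of smooth functions\<close>

abbreviation fderiv :: "('a::real_normed_vector \<Rightarrow> 'b::real_normed_vector) \<Rightarrow> 'a \<Rightarrow> 'a \<Rightarrow> 'b" where
  "fderiv f x \<equiv> frechet_derivative f (at x)"

text \<open>The outer derivative is taken in the direction of the first argument, the inner one in that of the second.\<close>

abbreviation fderiv2 ::
  "('a::real_normed_vector \<Rightarrow> 'b::real_normed_vector) \<Rightarrow> 'a \<Rightarrow> 'a \<Rightarrow> 'a \<Rightarrow> 'b" where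
  "fderiv2 f x a b \<equiv> fderiv (\<lambda>y. fderiv f y b) x a"

lemma has_derivative_fderiv:
  assumes "f differentiable (at x)"
  shows "(f has_derivative fderiv f x) (at x)"
  using assms frechet_derivative_works by blast

lemma fderiv_eqI:
  assumes "(f has_derivative f') (at x)"
  shows "fderiv f x = f'"
  using assms frechet_derivative_at by metis

lemma fderiv_cong_eventually:
  assumes "eventually (\<lambda>y. f y = g y) (nhds x)"
  shows "fderiv f x = fderiv g x"
proof -
  have fg: "f x = g x"
    using assms by (rule eventually_nhds_x_imp_x)
  have ev: "eventually (\<lambda>y. f y = g y) (at x)" "eventually (\<lambda>y. g y = f y) (at x)"
    using assms by (auto simp: eventually_at_filter elim: eventually_mono)
  have "(f has_derivative D) (at x) \<longleftrightarrow> (g has_derivative D) (at x)" for D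
    using has_derivative_transform_eventually[OF _ ev(1)]
      has_derivative_transform_eventually[OF _ ev(2)] fg by auto
  then show ?thesis
    unfolding frechet_derivative_def by simp
qed

lemma has_derivative_cong_eventually:
  assumes "(f has_derivative D) (at x)" and ev: "eventually (\<lambda>y. f y = g y) (nhds x)"
  shows "(g has_derivative D) (at x)"
proof (rule has_derivative_transform_eventually[OF assms(1)])
  show "eventually (\<lambda>y. f y = g y) (at x)"
    using ev by (auto simp: eventually_at_filter elim: eventually_mono)
qed (use eventually_nhds_x_imp_x[OF ev] in auto)

lemma k_times_differentiable_on_cong:
  assumes "open S" "\<And>x. x \<in> S \<Longrightarrow> f x = g x" "k_times_differentiable_on k f S"
  shows "k_times_differentiable_on k g S"
  using assms(2,3)
proof (induction k arbitrary: f g)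
  case 0
  then show ?case
    by (simp cong: continuous_on_cong)
next
  case (Suc k)
  have ev: "eventually (\<lambda>y. f y = g y) (nhds x)" if "x \<in> S" for x
    using Suc.prems(1) assms(1) that eventually_nhds by blast
  then have "frechet_derivative f (at x) = frechet_derivative g (at x)" if "x \<in> S" for x
    using that fderiv_cong_eventually by blast
  moreover have "g differentiable (at x)" if "x \<in> S" for x
    using has_derivative_cong_eventually[OF has_derivative_fderiv ev[OF that]] Suc.prems(2) that
    by (auto simp: differentiable_def)
  moreover have "k_times_differentiable_on k (\<lambda>x. fderiv g x h) S" for h
    using Suc.IH[of "\<lambda>x. fderiv f x h" "\<lambda>x. fderiv g x h"] Suc.prems(2) calculation(1) by simp
  ultimately show ?case
    by simp
qed

lemma smooth_on_cong:
  assumes "open S" "\<And>x. x \<in> S \<Longrightarrow> f x = g x" "smooth_on f S"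
  shows "smooth_on g S"
  using assms k_times_differentiable_on_cong unfolding smooth_on_def by blast

lemma smooth_on_imp_differentiable:
  assumes "smooth_on f S" "x \<in> S"
  shows "f differentiable (at x)"
proof -
  have "k_times_differentiable_on (Suc 0) f S"
    using assms(1) unfolding smooth_on_def by blast
  then show ?thesis
    using assms(2) by simp
qed

lemma smooth_on_imp_continuous_on:
  assumes "smooth_on f S"
  shows "continuous_on S f"
  using assms smooth_on_def k_times_differentiable_on.simps(1) by blast

lemma smooth_on_fderiv:
  assumes "smooth_on f S"
  shows "smooth_on (\<lambda>x. fderiv f x h) S"
  unfolding smooth_on_def
proof
  fix k
  have "k_times_differentiable_on (Suc k) f S"
    using assms unfolding smooth_on_def by blast
  then show "k_times_differentiable_on k (\<lambda>x. fderiv f x h) S"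
    by simp
qed

lemma k_times_differentiable_on_linear_comp:
  assumes "open S" "bounded_linear l" "k_times_differentiable_on k f S"
  shows "k_times_differentiable_on k (\<lambda>x. l (f x)) S"
  using assms(3)
proof (induction k arbitrary: f)
  case 0
  then show ?case
    using assms(2) by (simp add: bounded_linear.continuous_on)
next
  case (Suc k)
  have D: "((\<lambda>x. l (f x)) has_derivative (\<lambda>h. l (fderiv f x h))) (at x)" if "x \<in> S" for x
    using that Suc.prems by (intro bounded_linear.has_derivative[OF assms(2)] has_derivative_fderiv) auto
  have "k_times_differentiable_on k (\<lambda>x. fderiv (\<lambda>y. l (f y)) x h) S" for h
  proof (rule k_times_differentiable_on_cong[OF assms(1)])
    show "k_times_differentiable_on k (\<lambda>x. l (fderiv f x h)) S"
      using Suc by simp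
    show "l (fderiv f x h) = fderiv (\<lambda>y. l (f y)) x h" if "x \<in> S" for x
      using fderiv_eqI[OF D[OF that]] by simp
  qed
  then show ?case
    using D by (auto simp: differentiable_def)
qed

lemma smooth_on_linear_comp:
  assumes "open S" "bounded_linear l" "smooth_on f S"
  shows "smooth_on (\<lambda>x. l (f x)) S"
  using assms k_times_differentiable_on_linear_comp unfolding smooth_on_def by blast

lemma k_times_differentiable_on_Pair:
  assumes "open S" "k_times_differentiable_on k f S" "k_times_differentiable_on k g S"
  shows "k_times_differentiable_on k (\<lambda>x. (f x, g x)) S"
  using assms(2,3)
proof (induction k arbitrary: f g)
  case 0
  then show ?case
    by (simp add: continuous_on_Pair)
next
  case (Suc k)
  have D: "((\<lambda>x. (f x, g x)) has_derivative (\<lambda>h. (fderiv f x h, fderiv g x h))) (at x)"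
    if "x \<in> S" for x
    using that Suc.prems by (intro has_derivative_Pair has_derivative_fderiv) auto
  have "k_times_differentiable_on k (\<lambda>x. fderiv (\<lambda>x. (f x, g x)) x h) S" for h
  proof (rule k_times_differentiable_on_cong[OF assms(1)])
    show "k_times_differentiable_on k (\<lambda>x. (fderiv f x h, fderiv g x h)) S"
      using Suc by simp
    show "(fderiv f x h, fderiv g x h) = fderiv (\<lambda>x. (f x, g x)) x h" if "x \<in> S" for x
      using fderiv_eqI[OF D[OF that]] by simp
  qed
  then show ?case
    using D by (auto simp: differentiable_def)
qed

lemma smooth_on_Pair:
  assumes "open S" "smooth_on f S" "smooth_on g S"
  shows "smooth_on (\<lambda>x. (f x, g x)) S"
  using assms k_times_differentiable_on_Pair unfolding smooth_on_def by blast

lemma linear_fderiv: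
  assumes "f differentiable (at x)"
  shows "linear (fderiv f x)"
  using assms linear_frechet_derivative by blast

text \<open>
  The mean value theorem, applied first along \<open>h\<close> and then along \<open>k\<close>, turns the second difference quotient into
  a value of the mixed second derivative. The left-hand side is symmetric in \<open>h\<close> and \<open>k\<close>, so letting \<open>s\<close>
  tend to zero gives the symmetry of the second derivative.
\<close>

lemma second_difference_mean_value:
  fixes f :: "'a::real_normed_vector \<Rightarrow> real"
  assumes f: "smooth_on f S" and s: "s > 0"
    and par: "\<And>\<xi> \<eta>. 0 \<le> \<xi> \<Longrightarrow> \<xi> \<le> s \<Longrightarrow> 0 \<le> \<eta> \<Longrightarrow> \<eta> \<le> s \<Longrightarrow> x + \<xi> *\<^sub>R h + \<eta> *\<^sub>R k \<in> S"
  shows "\<exists>\<xi> \<eta>. 0 \<le> \<xi> \<and> \<xi> \<le> s \<and> 0 \<le> \<eta> \<and> \<eta> \<le> s \<and>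
           f (x + s *\<^sub>R h + s *\<^sub>R k) - f (x + s *\<^sub>R h) - f (x + s *\<^sub>R k) + f x
             = s * s * fderiv2 f (x + \<xi> *\<^sub>R h + \<eta> *\<^sub>R k) k h"
proof -
  have lin: "fderiv g y (c *\<^sub>R w) = c * fderiv g y w" if "smooth_on g S" "y \<in> S"
    for g :: "'a \<Rightarrow> real" and y c w
    using linear_fderiv[OF smooth_on_imp_differentiable[OF that]] by (simp add: linear_cmul)
  have line: "((\<lambda>r. g (y + r *\<^sub>R w)) has_derivative (\<lambda>c. c * fderiv g (y + r *\<^sub>R w) w)) (at r)"
    if "smooth_on g S" "y + r *\<^sub>R w \<in> S" for g :: "'a \<Rightarrow> real" and y r w
  proof -
    have "((\<lambda>r. y + r *\<^sub>R w) has_derivative (\<lambda>c. c *\<^sub>R w)) (at r)"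
      by (auto intro!: derivative_eq_intros)
    from has_derivative_compose[OF this has_derivative_fderiv[OF smooth_on_imp_differentiable[OF that]]]
    show ?thesis
      using lin[OF that] by simp
  qed
  define u where "u \<xi> = f ((x + s *\<^sub>R k) + \<xi> *\<^sub>R h) - f (x + \<xi> *\<^sub>R h)" for \<xi>
  have du: "(u has_derivative (\<lambda>c. c * (fderiv f (x + s *\<^sub>R k + \<xi> *\<^sub>R h) h
      - fderiv f (x + \<xi> *\<^sub>R h) h))) (at \<xi>)" if "0 \<le> \<xi>" "\<xi> \<le> s" for \<xi>
  proof -
    have 1: "x + s *\<^sub>R k + \<xi> *\<^sub>R h \<in> S" "x + \<xi> *\<^sub>R h \<in> S"
      using par[of \<xi> s] par[of \<xi> 0] that s by (auto simp: algebra_simps)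
    show ?thesis
      unfolding u_def right_diff_distrib
      by (intro has_derivative_diff line[OF f] 1)
  qed
  have "\<exists>\<xi>\<in>{0<..<s}. u s - u 0 = (s - 0) * (fderiv f (x + s *\<^sub>R k + \<xi> *\<^sub>R h) h
      - fderiv f (x + \<xi> *\<^sub>R h) h)"
    by (rule mvt_simple[OF s]) (auto intro: has_derivative_at_withinI[OF du])
  then obtain \<xi> where \<xi>: "0 < \<xi>" "\<xi> < s" and us: "u s - u 0 =
      s * (fderiv f (x + s *\<^sub>R k + \<xi> *\<^sub>R h) h - fderiv f (x + \<xi> *\<^sub>R h) h)"
    by auto
  define w where "w \<eta> = fderiv f (x + \<xi> *\<^sub>R h + \<eta> *\<^sub>R k) h" for \<eta>
  have dw: "(w has_derivative (\<lambda>c. c * fderiv2 f (x + \<xi> *\<^sub>R h + \<eta> *\<^sub>R k) k h)) (at \<eta>)"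
    if "0 \<le> \<eta>" "\<eta> \<le> s" for \<eta>
    unfolding w_def using line[OF smooth_on_fderiv[OF f] par[of \<xi> \<eta>]] \<xi> that by simp
  have "\<exists>\<eta>\<in>{0<..<s}. w s - w 0 = (s - 0) * fderiv2 f (x + \<xi> *\<^sub>R h + \<eta> *\<^sub>R k) k h"
    by (rule mvt_simple[OF s]) (auto intro: has_derivative_at_withinI[OF dw])
  then obtain \<eta> where \<eta>: "0 < \<eta>" "\<eta> < s"
    and ws: "w s - w 0 = s * fderiv2 f (x + \<xi> *\<^sub>R h + \<eta> *\<^sub>R k) k h"
    by auto
  have "w s - w 0 = fderiv f (x + s *\<^sub>R k + \<xi> *\<^sub>R h) h - fderiv f (x + \<xi> *\<^sub>R h) h"
    unfolding w_def by (simp add: ac_simps)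
  then have "u s - u 0 = s * s * fderiv2 f (x + \<xi> *\<^sub>R h + \<eta> *\<^sub>R k) k h"
    using us ws by simp
  then show ?thesis
    using \<xi> \<eta> unfolding u_def
    by (intro exI[of _ \<xi>] exI[of _ \<eta>]) (simp add: algebra_simps)
qed

lemma fderiv2_commute_real:
  fixes f :: "'a::real_normed_vector \<Rightarrow> real"
  assumes f: "smooth_on f S" and S: "open S" "x \<in> S"
  shows "fderiv2 f x h k = fderiv2 f x k h"
proof (rule ccontr)
  assume ne: "fderiv2 f x h k \<noteq> fderiv2 f x k h"
  define e where "e = \<bar>fderiv2 f x h k - fderiv2 f x k h\<bar> / 2"
  have e: "e > 0"
    using ne by (simp add: e_def)
  have cont: "isCont (\<lambda>y. fderiv2 f y a b) x" for a b
    using smooth_on_imp_continuous_on[OF smooth_on_fderiv[OF smooth_on_fderiv[OF f]]] S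
    by (simp add: continuous_on_eq_continuous_at)
  obtain d1 where d1: "d1 > 0" "\<And>y. dist y x < d1 \<Longrightarrow> dist (fderiv2 f y h k) (fderiv2 f x h k) < e"
    using cont[where a=h and b=k, unfolded continuous_at_eps_delta, rule_format, OF e] by auto
  obtain d2 where d2: "d2 > 0" "\<And>y. dist y x < d2 \<Longrightarrow> dist (fderiv2 f y k h) (fderiv2 f x k h) < e"
    using cont[where a=k and b=h, unfolded continuous_at_eps_delta, rule_format, OF e] by auto
  obtain d3 where d3: "d3 > 0" "\<And>y. dist y x < d3 \<Longrightarrow> y \<in> S"
    using S open_dist by metis
  define d where "d = min d1 (min d2 d3)"
  have d: "d > 0"
    using d1 d2 d3 by (simp add: d_def)
  define s where "s = d / (norm h + norm k + 1)"
  have N: "norm h + norm k + 1 > 0"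
    by (simp add: add_nonneg_pos)
  have s: "s > 0"
    using d N by (simp add: s_def)
  have near: "dist (x + \<xi> *\<^sub>R a + \<eta> *\<^sub>R b) x < d"
    if "0 \<le> \<xi>" "\<xi> \<le> s" "0 \<le> \<eta>" "\<eta> \<le> s" "norm a + norm b = norm h + norm k" for \<xi> \<eta> a b
  proof -
    have "dist (x + \<xi> *\<^sub>R a + \<eta> *\<^sub>R b) x \<le> \<xi> * norm a + \<eta> * norm b"
      using norm_triangle_ineq[of "\<xi> *\<^sub>R a" "\<eta> *\<^sub>R b"] that by (simp add: dist_norm add.assoc)
    also have "\<dots> \<le> s * norm a + s * norm b"
      using that by (intro add_mono mult_right_mono) auto
    also have "\<dots> < s * (norm h + norm k + 1)"
      using s that(5) by (simp flip: distrib_left)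
    also have "\<dots> = d"
      using N by (simp add: s_def)
    finally show ?thesis .
  qed
  have inS: "x + \<xi> *\<^sub>R a + \<eta> *\<^sub>R b \<in> S"
    if "0 \<le> \<xi>" "\<xi> \<le> s" "0 \<le> \<eta>" "\<eta> \<le> s" "norm a + norm b = norm h + norm k" for \<xi> \<eta> a b
    using near[OF that] d3 by (simp add: d_def)
  obtain \<xi> \<eta> where 1: "0 \<le> \<xi>" "\<xi> \<le> s" "0 \<le> \<eta>" "\<eta> \<le> s" and
    eq1: "f (x + s *\<^sub>R h + s *\<^sub>R k) - f (x + s *\<^sub>R h) - f (x + s *\<^sub>R k) + f x
             = s * s * fderiv2 f (x + \<xi> *\<^sub>R h + \<eta> *\<^sub>R k) k h"
    using second_difference_mean_value[OF f s, of x h k] inS by auto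
  obtain \<xi>' \<eta>' where 2: "0 \<le> \<xi>'" "\<xi>' \<le> s" "0 \<le> \<eta>'" "\<eta>' \<le> s" and
    eq2: "f (x + s *\<^sub>R k + s *\<^sub>R h) - f (x + s *\<^sub>R k) - f (x + s *\<^sub>R h) + f x
             = s * s * fderiv2 f (x + \<xi>' *\<^sub>R k + \<eta>' *\<^sub>R h) h k"
    using second_difference_mean_value[OF f s, of x k h] inS by (auto simp: add.commute)
  have swap: "x + s *\<^sub>R k + s *\<^sub>R h = x + s *\<^sub>R h + s *\<^sub>R k"
    by simp
  have "s * s * fderiv2 f (x + \<xi> *\<^sub>R h + \<eta> *\<^sub>R k) k h
      = s * s * fderiv2 f (x + \<xi>' *\<^sub>R k + \<eta>' *\<^sub>R h) h k"
    using eq1 eq2[unfolded swap] by linarith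
  then have "fderiv2 f (x + \<xi> *\<^sub>R h + \<eta> *\<^sub>R k) k h = fderiv2 f (x + \<xi>' *\<^sub>R k + \<eta>' *\<^sub>R h) h k"
    using s by simp
  moreover have "\<bar>fderiv2 f (x + \<xi> *\<^sub>R h + \<eta> *\<^sub>R k) k h - fderiv2 f x k h\<bar> < e"
    using d2(2) near[OF 1] by (simp add: d_def dist_real_def)
  moreover have "\<bar>fderiv2 f (x + \<xi>' *\<^sub>R k + \<eta>' *\<^sub>R h) h k - fderiv2 f x h k\<bar> < e"
    using d1(2) near[OF 2] by (simp add: d_def dist_real_def add.commute)
  ultimately show False
    unfolding e_def by (smt (verit) field_sum_of_halves)
qed

lemma fderiv_inner_left:
  assumes "f differentiable (at x)"
  shows "fderiv (\<lambda>y. f y \<bullet> b) x = (\<lambda>h. fderiv f x h \<bullet> b)"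
  by (rule fderiv_eqI) (intro has_derivative_inner_left has_derivative_fderiv assms)

lemma fderiv2_commute:
  fixes f :: "'a::real_normed_vector \<Rightarrow> 'b::real_inner"
  assumes f: "smooth_on f S" and S: "open S" "x \<in> S"
  shows "fderiv2 f x h k = fderiv2 f x k h"
proof -
  have "fderiv2 f x a c \<bullet> b = fderiv2 (\<lambda>y. f y \<bullet> b) x a c" for a b c
  proof -
    have "eventually (\<lambda>y. fderiv (\<lambda>y. f y \<bullet> b) y c = fderiv f y c \<bullet> b) (nhds x)"
      using S fderiv_inner_left[OF smooth_on_imp_differentiable[OF f]]
      by (auto simp: eventually_nhds)
    then show ?thesis
      using fderiv_inner_left[OF smooth_on_imp_differentiable[OF smooth_on_fderiv[OF f] S(2)]]
      by (simp cong: fderiv_cong_eventually add: fderiv_cong_eventually)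
  qed
  moreover have "smooth_on (\<lambda>y. f y \<bullet> b) S" for b
    by (rule smooth_on_linear_comp[OF S(1) bounded_linear_inner_left f])
  ultimately have "fderiv2 f x h k \<bullet> b = fderiv2 f x k h \<bullet> b" for b
    using fderiv2_commute_real S by metis
  then show ?thesis
    by (metis inner_commute vector_eq_rdot)
qed

lemma linear_fderiv2_right:
  assumes f: "smooth_on f S" and S: "open S" "x \<in> S"
  shows "linear (\<lambda>b. fderiv2 f x a b)"
proof -
  have D: "((\<lambda>y. fderiv f y b) has_derivative (\<lambda>a. fderiv2 f x a b)) (at x)" for b
    by (rule has_derivative_fderiv[OF smooth_on_imp_differentiable[OF smooth_on_fderiv[OF f] S(2)]])
  have lin: "linear (fderiv f y)" if "y \<in> S" for y
    using linear_fderiv[OF smooth_on_imp_differentiable[OF f that]] .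
  have ev: "eventually (\<lambda>y. y \<in> S) (nhds x)"
    using S by (simp add: eventually_nhds_in_open)
  show ?thesis
  proof
    fix b c
    have "((\<lambda>y. fderiv f y (b + c)) has_derivative (\<lambda>a. fderiv2 f x a b + fderiv2 f x a c)) (at x)"
      by (rule has_derivative_cong_eventually[OF has_derivative_add[OF D D]])
        (rule eventually_mono[OF ev], simp add: linear_add[OF lin])
    from fun_cong[OF fderiv_eqI[OF this], of a]
    show "fderiv2 f x a (b + c) = fderiv2 f x a b + fderiv2 f x a c" .
  next
    fix r b
    have "((\<lambda>y. fderiv f y (r *\<^sub>R b)) has_derivative (\<lambda>a. r *\<^sub>R fderiv2 f x a b)) (at x)"
      by (rule has_derivative_cong_eventually[OF has_derivative_scaleR_right[OF D]])
        (rule eventually_mono[OF ev], simp add: linear_cmul[OF lin])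
    from fun_cong[OF fderiv_eqI[OF this], of a]
    show "fderiv2 f x a (r *\<^sub>R b) = r *\<^sub>R fderiv2 f x a b" .
  qed
qed

lemma linear_fderiv2_left:
  assumes "smooth_on f S" "x \<in> S"
  shows "linear (\<lambda>a. fderiv2 f x a b)"
  by (rule linear_fderiv[OF smooth_on_imp_differentiable[OF smooth_on_fderiv[OF assms(1)] assms(2)]])

text \<open>The tangent map of \<open>f\<close>, in the product coordinates \<open>(x, v)\<close> that natural charts provide.\<close>

definition tangent_fun ::
  "('a::real_normed_vector \<Rightarrow> 'b::real_normed_vector) \<Rightarrow> 'a \<times> 'a \<Rightarrow> 'b \<times> 'b" where
  "tangent_fun f z = (f (fst z), fderiv f (fst z) (snd z))"

text \<open>
  In finite dimension \<open>Df(x) v\<close> is the finite sum of the \<open>v\<^sub>b Df(x) b\<close> over basis vectors \<open>b\<close>. This reduces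
  joint differentiability in \<open>(x, v)\<close> to differentiability of \<open>Df(x) b\<close> in \<open>x\<close> for each fixed \<open>b\<close>.
\<close>

lemma has_derivative_fderiv_joint:
  fixes f :: "'a::euclidean_space \<Rightarrow> 'b::real_normed_vector"
  assumes f: "smooth_on f S" and S: "open S" "x \<in> S"
  shows "((\<lambda>z. fderiv f (fst z) (snd z)) has_derivative
           (\<lambda>h. fderiv2 f x (fst h) v + fderiv f x (snd h))) (at (x, v))"
proof -
  have D: "((\<lambda>y. fderiv f y b) has_derivative (\<lambda>a. fderiv2 f x a b)) (at x)" for b
    by (rule has_derivative_fderiv[OF smooth_on_imp_differentiable[OF smooth_on_fderiv[OF f] S(2)]])
  have D': "((\<lambda>z. fderiv f (fst z) b) has_derivative (\<lambda>h. fderiv2 f x (fst h) b)) (at (x, v))" for b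
    by (rule has_derivative_compose[OF has_derivative_fst[OF has_derivative_ident],
          where g = "\<lambda>y. fderiv f y b"]) (simp add: D)
  have sum: "(\<Sum>b\<in>Basis. (w \<bullet> b) *\<^sub>R l b) = l w" if "linear l" for l :: "'a \<Rightarrow> 'b" and w
    using linear_sum[OF that, of "\<lambda>b. (w \<bullet> b) *\<^sub>R b" Basis] linear_cmul[OF that]
    by (simp add: euclidean_representation)
  have lin: "linear (fderiv f y)" if "y \<in> S" for y
    using linear_fderiv[OF smooth_on_imp_differentiable[OF f that]] .
  have "((\<lambda>z. \<Sum>b\<in>Basis. (snd z \<bullet> b) *\<^sub>R fderiv f (fst z) b) has_derivative
     (\<lambda>h. \<Sum>b\<in>Basis. (v \<bullet> b) *\<^sub>R fderiv2 f x (fst h) b + (snd h \<bullet> b) *\<^sub>R fderiv f x b)) (at (x, v))"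
    by (rule derivative_eq_intros D' refl | simp)+
  also have "(\<lambda>h. \<Sum>b\<in>Basis. (v \<bullet> b) *\<^sub>R fderiv2 f x (fst h) b + (snd h \<bullet> b) *\<^sub>R fderiv f x b)
      = (\<lambda>h. fderiv2 f x (fst h) v + fderiv f x (snd h))"
    using sum[OF lin[OF S(2)]] sum[OF linear_fderiv2_right[OF f S]] by (simp add: sum.distrib)
  finally show ?thesis
  proof (rule has_derivative_cong_eventually)
    have "open (S \<times> (UNIV :: 'a set))"
      using S open_Times by blast
    then have "eventually (\<lambda>z. z \<in> S \<times> UNIV) (nhds (x, v))"
      using S by (simp add: eventually_nhds_in_open)
    then show "\<forall>\<^sub>F z in nhds (x, v). (\<Sum>b\<in>Basis. (snd z \<bullet> b) *\<^sub>R fderiv f (fst z) b)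
        = fderiv f (fst z) (snd z)"
      by (rule eventually_mono) (use sum lin in auto)
  qed
qed

lemma has_derivative_tangent_fun:
  fixes f :: "'a::euclidean_space \<Rightarrow> 'b::real_normed_vector"
  assumes f: "smooth_on f S" and S: "open S" "x \<in> S"
  shows "(tangent_fun f has_derivative
           (\<lambda>h. (fderiv f x (fst h), fderiv2 f x (fst h) v + fderiv f x (snd h)))) (at (x, v))"
proof -
  have "((\<lambda>z. f (fst z)) has_derivative (\<lambda>h. fderiv f x (fst h))) (at (x, v))"
    by (rule has_derivative_compose[OF has_derivative_fst[OF has_derivative_ident], where g = f])
      (simp add: has_derivative_fderiv[OF smooth_on_imp_differentiable[OF f S(2)]])
  from has_derivative_Pair[OF this has_derivative_fderiv_joint[OF f S]]
  show ?thesis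
    unfolding tangent_fun_def .
qed

section \<open>Euler--Lagrange residuals in coordinates\<close>

text \<open>
  The Euler--Lagrange expression of \<open>\<Lambda>\<close> at the state \<open>z = (x, v)\<close> of a motion with acceleration \<open>s\<close>,
  paired with the virtual displacement \<open>a\<close>.
\<close>

definition EL_residual :: "('e::real_normed_vector \<times> 'e \<Rightarrow> real) \<Rightarrow> 'e \<times> 'e \<Rightarrow> 'e \<Rightarrow> 'e \<Rightarrow> real" where
  "EL_residual \<Lambda> z s a = fderiv \<Lambda> z (a, 0) - fderiv2 \<Lambda> z (snd z, s) (0, a)"

lemma linear_Pair_left: "linear (\<lambda>a. (a, 0))"
  by (rule linearI) auto

lemma linear_Pair_right: "linear (\<lambda>a. (0, a))"
  by (rule linearI) auto

lemma linear_EL_residual: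
  assumes \<Lambda>: "smooth_on \<Lambda> W" and W: "open W" "z \<in> W"
  shows "linear (EL_residual \<Lambda> z s)"
proof -
  have "linear (\<lambda>a. fderiv \<Lambda> z (a, 0) - fderiv2 \<Lambda> z (snd z, s) (0, a))"
    using linear_compose[OF linear_Pair_left linear_fderiv[OF smooth_on_imp_differentiable[OF \<Lambda> W(2)]]]
      linear_compose[OF linear_Pair_right linear_fderiv2_right[OF \<Lambda> W]]
    by (intro linear_compose_sub) (simp_all add: o_def)
  then show ?thesis
    unfolding EL_residual_def .
qed

lemma EL_residual_diff:
  assumes \<Lambda>: "smooth_on \<Lambda> W" "z \<in> W"
  shows "EL_residual \<Lambda> z s a - EL_residual \<Lambda> z s' a = - fderiv2 \<Lambda> z (0, s - s') (0, a)"
  using linear_diff[OF linear_fderiv2_left[OF \<Lambda>, where b = "(0, a)"], of "(snd z, s)" "(snd z, s')"]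
  by (simp add: EL_residual_def)

text \<open>
  Nondegeneracy makes \<open>w \<mapsto> B _ w\<close> injective, hence surjective onto the functionals by dimension. This solves
  two linear systems below: the one hidden in \<open>\<sharp>\<close>, and the one that completes a position vector to an
  element of the kernel of the reduced tensor.
\<close>

lemma nondegenerate_bilinear_represents:
  fixes B :: "'e::euclidean_space \<Rightarrow> 'e \<Rightarrow> real"
  assumes left: "\<And>w. linear (\<lambda>u. B u w)" and right: "\<And>u. linear (\<lambda>w. B u w)"
    and nondeg: "\<And>w. (\<And>u. B u w = 0) \<Longrightarrow> w = 0"
    and l: "linear l"
  obtains w where "\<And>u. B u w = l u"
proof -
  have riesz: "k u = (\<Sum>b\<in>Basis. k b *\<^sub>R b) \<bullet> u" if "linear k" for k :: "'e \<Rightarrow> real" and u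
  proof -
    have "k u = k (\<Sum>b\<in>Basis. (u \<bullet> b) *\<^sub>R b)"
      by (simp add: euclidean_representation)
    also have "\<dots> = (\<Sum>b\<in>Basis. (u \<bullet> b) *\<^sub>R k b)"
      using that by (simp add: linear_sum linear_cmul)
    also have "\<dots> = (\<Sum>b\<in>Basis. k b *\<^sub>R b) \<bullet> u"
      by (simp add: inner_sum_right inner_commute[of _ u] mult.commute)
    finally show ?thesis .
  qed
  define T where "T w = (\<Sum>b\<in>Basis. B b w *\<^sub>R b)" for w
  have T: "T w \<bullet> u = B u w" for u w
    using riesz[OF left[of w], of u] by (simp add: T_def)
  have "linear T"
    unfolding T_def
    using linear_add[OF right] linear_cmul[OF right]
    by (intro linearI) (simp_all add: scaleR_add_left sum.distrib scaleR_sum_right)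
  moreover have "inj T"
  proof -
    have "w = 0" if "T w = 0" for w
    proof (rule nondeg)
      show "B u w = 0" for u
        using T[of w u] that by simp
    qed
    then show ?thesis
      using linear_injective_0[OF \<open>linear T\<close>] by blast
  qed
  ultimately have "surj T"
    using linear_injective_imp_surjective by blast
  then obtain w where "T w = (\<Sum>b\<in>Basis. l b *\<^sub>R b)"
    by (metis surjD)
  then have "B u w = l u" for u
    using T[of w u] riesz[OF l, of u] by simp
  then show thesis
    using that by blast
qed

text \<open>
  The coordinate expressions \<open>F\<close> of a map of configuration manifolds and \<open>\<Lambda>\<close> of a Lagrangian, near a fixed
  state \<open>(x, v)\<close>; the pulled back Lagrangian is \<open>\<Lambda> \<circ> tangent_fun F\<close>. The linear map \<open>d\<phi>\<close> is the differential of
  \<open>tangent_fun F\<close>, that is, of the lifted embedding, at that state.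
\<close>

locale lagrangian_pullback =
  fixes F :: "'e::euclidean_space \<Rightarrow> 'f::euclidean_space" and \<Lambda> :: "'f \<times> 'f \<Rightarrow> real" and U W x v
  assumes F: "smooth_on F U" and U: "open U" "x \<in> U"
    and \<Lambda>: "smooth_on \<Lambda> W" and W: "open W" "tangent_fun F (x, v) \<in> W"
begin

definition d\<phi> :: "'e \<times> 'e \<Rightarrow> 'f \<times> 'f" where
  "d\<phi> h = (fderiv F x (fst h), fderiv2 F x (fst h) v + fderiv F x (snd h))"

lemma has_derivative_tangent_fun_F: "(tangent_fun F has_derivative d\<phi>) (at (x, v))"
  using has_derivative_tangent_fun[OF F U] unfolding d\<phi>_def .

lemma linear_F: "linear (fderiv F x)"
  using linear_fderiv[OF smooth_on_imp_differentiable[OF F U(2)]] .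

lemma fderiv_pullback:
  "fderiv (\<Lambda> \<circ> tangent_fun F) (x, v) h = fderiv \<Lambda> (tangent_fun F (x, v)) (d\<phi> h)"
  using fun_cong[OF fderiv_eqI[OF has_derivative_compose[OF has_derivative_tangent_fun_F
        has_derivative_fderiv[OF smooth_on_imp_differentiable[OF \<Lambda> W(2)]]]], of h]
  by (simp add: o_def)

text \<open>
  Near \<open>(x, v)\<close> the velocity derivative of the pulled back Lagrangian is \<open>D\<Lambda>\<close> evaluated at a moving point
  and in a moving direction; both contribute to its derivative.
\<close>

lemma has_derivative_velocity_derivative_pullback:
  "((\<lambda>z. fderiv (\<Lambda> \<circ> tangent_fun F) z (0, a)) has_derivative
     (\<lambda>h. fderiv2 \<Lambda> (tangent_fun F (x, v)) (d\<phi> h) (0, fderiv F x a)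
        + fderiv \<Lambda> (tangent_fun F (x, v)) (0, fderiv2 F x (fst h) a))) (at (x, v))"
proof -
  have D: "((\<lambda>y. fderiv F y a) has_derivative (\<lambda>c. fderiv2 F x c a)) (at x)"
    by (rule has_derivative_fderiv[OF smooth_on_imp_differentiable[OF smooth_on_fderiv[OF F] U(2)]])
  have D': "((\<lambda>z. fderiv F (fst z) a) has_derivative (\<lambda>h. fderiv2 F x (fst h) a)) (at (x, v))"
    by (rule has_derivative_compose[OF has_derivative_fst[OF has_derivative_ident],
          where g = "\<lambda>y. fderiv F y a"]) (simp add: D)
  have "((\<lambda>z. (tangent_fun F z, (0, fderiv F (fst z) a))) has_derivative
      (\<lambda>h. (d\<phi> h, (0, fderiv2 F x (fst h) a)))) (at (x, v))"
    by (intro has_derivative_Pair has_derivative_tangent_fun_F D' has_derivative_const)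
  note chain = has_derivative_compose[OF this, where g = "\<lambda>z. fderiv \<Lambda> (fst z) (snd z)"
      and g' = "\<lambda>h. fderiv2 \<Lambda> (tangent_fun F (x, v)) (fst h) (0, fderiv F x a)
        + fderiv \<Lambda> (tangent_fun F (x, v)) (snd h)"]
  have "((\<lambda>z. fderiv \<Lambda> (tangent_fun F z) (0, fderiv F (fst z) a)) has_derivative
     (\<lambda>h. fderiv2 \<Lambda> (tangent_fun F (x, v)) (d\<phi> h) (0, fderiv F x a)
        + fderiv \<Lambda> (tangent_fun F (x, v)) (0, fderiv2 F x (fst h) a))) (at (x, v))"
    using chain has_derivative_fderiv_joint[OF \<Lambda> W, of "(0, fderiv F x a)"] by simp
  then show ?thesis
  proof (rule has_derivative_cong_eventually)
    have "isCont (tangent_fun F) (x, v)"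
      using has_derivative_tangent_fun_F has_derivative_continuous by blast
    then have "eventually (\<lambda>z. tangent_fun F z \<in> W) (nhds (x, v))"
      using W by (simp add: continuous_at_open eventually_nhds)
    moreover have "eventually (\<lambda>z. z \<in> U \<times> UNIV) (nhds (x, v))"
      using U by (simp add: eventually_nhds_in_open open_Times)
    ultimately show "\<forall>\<^sub>F z in nhds (x, v). fderiv \<Lambda> (tangent_fun F z) (0, fderiv F (fst z) a)
        = fderiv (\<Lambda> \<circ> tangent_fun F) z (0, a)"
    proof eventually_elim
      case (elim z)
      interpret z: lagrangian_pullback F \<Lambda> U W "fst z" "snd z"
        using F U \<Lambda> W elim by unfold_locales auto
      show ?case
        using z.fderiv_pullback[of "(0, a)"] linear_0[OF z.linear_F]
          linear_0[OF linear_fderiv2_left[OF F z.U(2)]] by (simp add: z.d\<phi>_def)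
    qed
  qed
qed

lemma fderiv2_pullback:
  "fderiv2 (\<Lambda> \<circ> tangent_fun F) (x, v) h (0, a)
     = fderiv2 \<Lambda> (tangent_fun F (x, v)) (d\<phi> h) (0, fderiv F x a)
       + fderiv \<Lambda> (tangent_fun F (x, v)) (0, fderiv2 F x (fst h) a)"
  using fun_cong[OF fderiv_eqI[OF has_derivative_velocity_derivative_pullback[of a]], of h] .

lemma velocity_hessian_pullback:
  "fderiv2 (\<Lambda> \<circ> tangent_fun F) (x, v) (0, b) (0, a)
     = fderiv2 \<Lambda> (tangent_fun F (x, v)) (0, fderiv F x b) (0, fderiv F x a)"
  using linear_0[OF linear_F] linear_0[OF linear_fderiv2_left[OF F U(2)]]
    linear_0[OF linear_fderiv[OF smooth_on_imp_differentiable[OF \<Lambda> W(2)]]]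
  by (simp add: fderiv2_pullback d\<phi>_def zero_prod_def)

text \<open>
  The Euler--Lagrange expression is natural: the residual of the pulled back Lagrangian is the pullback of
  the residual. The terms containing \<open>D\<Lambda> (0, D\<^sup>2 F)\<close> cancel because the second derivative of \<open>F\<close> is symmetric.
\<close>

lemma EL_residual_pullback:
  "EL_residual (\<Lambda> \<circ> tangent_fun F) (x, v) s a
     = EL_residual \<Lambda> (tangent_fun F (x, v)) (fderiv2 F x v v + fderiv F x s) (fderiv F x a)"
proof -
  note linD = linear_fderiv[OF smooth_on_imp_differentiable[OF \<Lambda> W(2)]]
  have "fderiv \<Lambda> (tangent_fun F (x, v)) (fderiv F x a, fderiv2 F x a v)
      = fderiv \<Lambda> (tangent_fun F (x, v)) (fderiv F x a, 0)
        + fderiv \<Lambda> (tangent_fun F (x, v)) (0, fderiv2 F x v a)"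
    using linear_add[OF linD, of "(fderiv F x a, 0)" "(0, fderiv2 F x v a)"]
      fderiv2_commute[OF F U, of a v] by simp
  then show ?thesis
    using linear_0[OF linear_F]
    by (simp add: EL_residual_def fderiv_pullback fderiv2_pullback d\<phi>_def tangent_fun_def)
qed

lemma linear_EL_residual_pullback: "linear (EL_residual (\<Lambda> \<circ> tangent_fun F) (x, v) s)"
proof -
  have "linear (\<lambda>a. EL_residual (\<Lambda> \<circ> tangent_fun F) (x, v) s a)"
    unfolding EL_residual_pullback
    using linear_compose[OF linear_F linear_EL_residual[OF \<Lambda> W]] by (simp add: o_def)
  then show ?thesis .
qed

text \<open>
  The Galerkin equation of the reduction map, in coordinates: \<open>k\<close> stands for the block \<open>\<tau>\<^sub>q\<close> and the velocity
  Hessian of \<open>\<Lambda>\<close> for the block \<open>\<tau>\<^sub>v\<close> of the tensor; \<open>(p, s)\<close> is the reduced velocity and \<open>(DF v, A)\<close> the full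
  vector field. Testing with \<open>(0, b)\<close> gives a homogeneous equation for \<open>p - v\<close>; completing a
  solution of it to an element of the kernel of the reduced tensor shows that \<open>p = v\<close>. Testing with
  \<open>(a, 0)\<close> is then the pulled back Euler--Lagrange residual.
\<close>

lemma Galerkin_equation_iff:
  fixes k :: "'f \<Rightarrow> 'f \<Rightarrow> real" and A :: 'f
  defines "\<tau> \<equiv> \<lambda>u w. k (snd u) (fst w) + fderiv2 \<Lambda> (tangent_fun F (x, v)) (0, fst u) (0, snd w)"
  assumes k: "\<And>w. linear (\<lambda>u. k u w)" "\<And>u. linear (\<lambda>w. k u w)"
    and nondeg: "\<And>w. (\<And>u. \<tau> (d\<phi> u) (d\<phi> w) = 0) \<Longrightarrow> w = 0"
    and regular: "\<And>b. (\<And>a. fderiv2 (\<Lambda> \<circ> tangent_fun F) (x, v) (0, a) (0, b) = 0) \<Longrightarrow> b = 0"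
    and A: "\<And>a. EL_residual \<Lambda> (tangent_fun F (x, v)) A a = 0"
  shows "(\<forall>u. \<tau> (d\<phi> u) (d\<phi> (p, s)) = \<tau> (d\<phi> u) (fderiv F x v, A)) \<longleftrightarrow>
           p = v \<and> (\<forall>a. EL_residual (\<Lambda> \<circ> tangent_fun F) (x, v) s a = 0)"
proof -
  define H where "H a b = fderiv2 \<Lambda> (tangent_fun F (x, v)) (0, a) (0, b)" for a b
  have H: "linear (\<lambda>a. H a b)" "linear (\<lambda>b. H a b)" for a b
    unfolding H_def
    using linear_compose[OF linear_Pair_right linear_fderiv2_left[OF \<Lambda> W(2)]]
      linear_compose[OF linear_Pair_right linear_fderiv2_right[OF \<Lambda> W]]
    by (simp_all add: o_def)
  have H_commute: "H a b = H b a" for a b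
    unfolding H_def by (rule fderiv2_commute[OF \<Lambda> W])
  have \<tau>: "\<tau> u w = k (snd u) (fst w) + H (fst u) (snd w)" for u w
    by (simp add: \<tau>_def H_def)
  note D2F = linear_fderiv2_left[OF F U(2), of v]
  have d\<phi>: "d\<phi> (a, b) = (fderiv F x a, fderiv2 F x a v + fderiv F x b)" for a b
    by (simp add: d\<phi>_def)
  have residual: "EL_residual (\<Lambda> \<circ> tangent_fun F) (x, v) s a
      = - H (fderiv F x a) (fderiv2 F x v v + fderiv F x s - A)" for a
    using EL_residual_diff[OF \<Lambda> W(2), of "fderiv2 F x v v + fderiv F x s" "fderiv F x a" A] A
      H_commute
    by (simp add: EL_residual_pullback H_def)
  have diff: "\<tau> u w - \<tau> u w' = k (snd u) (fst w - fst w') + H (fst u) (snd w - snd w')" for u w w'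
    by (simp add: \<tau> linear_diff[OF k(2)] linear_diff[OF H(2)])
  show ?thesis
  proof
    assume "p = v \<and> (\<forall>a. EL_residual (\<Lambda> \<circ> tangent_fun F) (x, v) s a = 0)"
    then have "\<tau> (d\<phi> u) (d\<phi> (p, s)) - \<tau> (d\<phi> u) (fderiv F x v, A) = 0" for u
      using residual[of "fst u"]
      by (simp add: diff d\<phi>_def linear_0[OF k(2)])
    then show "\<forall>u. \<tau> (d\<phi> u) (d\<phi> (p, s)) = \<tau> (d\<phi> u) (fderiv F x v, A)"
      by simp
  next
    assume eq: "\<forall>u. \<tau> (d\<phi> u) (d\<phi> (p, s)) = \<tau> (d\<phi> u) (fderiv F x v, A)"
    define r where "r = p - v"
    have F_r: "fderiv F x p - fderiv F x v = fderiv F x r"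
      by (simp add: r_def linear_diff[OF linear_F])
    have test: "k (fderiv2 F x a v + fderiv F x b) (fderiv F x r)
        + H (fderiv F x a) (fderiv2 F x p v + fderiv F x s - A) = 0" for a b
      using eq diff[of "d\<phi> (a, b)" "d\<phi> (p, s)" "(fderiv F x v, A)"] by (simp add: d\<phi> F_r)
    have test_vertical: "k (fderiv F x b) (fderiv F x r) = 0" for b
      using test[of 0 b]
      by (simp add: linear_0[OF linear_F] linear_0[OF D2F] linear_0[OF H(1)])
    \<comment> \<open>Solvability of \<open>H (DF a) (DF b) = l a\<close> for \<open>b\<close> is where regularity of the reduced Lagrangian enters;
      the functional \<open>l\<close> is chosen so that \<open>(r, b)\<close> lies in the kernel of the reduced tensor.\<close>
    define l where "l a = - (k (fderiv2 F x a v) (fderiv F x r)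
        + H (fderiv F x a) (fderiv2 F x r v))" for a
    have "linear l"
      unfolding l_def
      using linear_compose[OF D2F k(1)] linear_compose[OF linear_F H(1)]
      by (intro linear_compose_neg linear_compose_add) (simp_all add: o_def)
    moreover have "b = 0" if "\<And>a. H (fderiv F x a) (fderiv F x b) = 0" for b
      using that regular by (simp add: velocity_hessian_pullback H_def)
    ultimately obtain b where b: "\<And>a. H (fderiv F x a) (fderiv F x b) = l a"
      using nondegenerate_bilinear_represents[of "\<lambda>a b. H (fderiv F x a) (fderiv F x b)" l]
        linear_compose[OF linear_F H(1)] linear_compose[OF linear_F H(2)]
      by (auto simp: o_def)
    have "(r, b) = 0"
    proof (rule nondeg)
      fix u
      show "\<tau> (d\<phi> u) (d\<phi> (r, b)) = 0"
        using b[of "fst u"] test_vertical[of "snd u"]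
        by (simp add: \<tau> d\<phi>_def l_def linear_add[OF k(1)] linear_add[OF H(2)])
    qed
    then have "p = v"
      by (simp add: r_def zero_prod_def)
    moreover have "EL_residual (\<Lambda> \<circ> tangent_fun F) (x, v) s a = 0" for a
      using test[of a 0] \<open>p = v\<close>
      by (simp add: residual r_def linear_0[OF linear_F] linear_0[OF k(2)])
    ultimately show "p = v \<and> (\<forall>a. EL_residual (\<Lambda> \<circ> tangent_fun F) (x, v) s a = 0)"
      by blast
  qed
qed

end

section \<open>Tangent vectors in charts\<close>

lemma chart_inv_eq:
  assumes "inj_on (snd c) (fst c)" "p \<in> fst c"
  shows "chart_inv c (snd c p) = p"
  using assms by (simp add: chart_inv_def)

text \<open>
  The calculus of tangent vectors is developed once, for a manifold and for its tangent bundle. In both cases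
  it rests on differentiable transition maps between open sets; for the tangent bundle
  these are the tangent maps of the transition maps of the base.
\<close>

lemma tangent_spaceI:
  assumes "\<And>c d. c \<in> charts_at M p \<Longrightarrow> d \<in> charts_at M p
      \<Longrightarrow> v d = fderiv (snd d \<circ> chart_inv c) (snd c p) (v c)"
    and "\<And>c. c \<notin> charts_at M p \<Longrightarrow> v c = 0"
  shows "v \<in> tangent_space M p"
  using assms unfolding tangent_space_def by blast

lemma tangent_space_transition:
  assumes "v \<in> tangent_space M p" "c \<in> charts_at M p" "d \<in> charts_at M p"
  shows "fderiv (snd d \<circ> chart_inv c) (snd c p) (v c) = v d"
proof -
  have "\<forall>c\<in>charts_at M p. \<forall>d\<in>charts_at M p. v d = fderiv (snd d \<circ> chart_inv c) (snd c p) (v c)"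
    using assms(1) unfolding tangent_space_def by blast
  from this[rule_format, OF assms(2,3)] show ?thesis
    by (rule sym)
qed

lemma tangent_space_outside:
  assumes "v \<in> tangent_space M p" "c \<notin> charts_at M p"
  shows "v c = 0"
  using assms unfolding tangent_space_def by blast

locale differentiable_atlas =
  fixes M :: "('a, 'e::euclidean_space) mfd"
  assumes chart_inj: "c \<in> atlas M \<Longrightarrow> inj_on (snd c) (fst c)"
    and open_overlap: "c \<in> atlas M \<Longrightarrow> d \<in> atlas M \<Longrightarrow> open (snd c ` (fst c \<inter> fst d))"
    and transition_differentiable:
      "c \<in> charts_at M p \<Longrightarrow> d \<in> charts_at M p \<Longrightarrow> (snd d \<circ> chart_inv c) differentiable (at (snd c p))"
begin

lemma chart_inv_chart: "c \<in> atlas M \<Longrightarrow> p \<in> fst c \<Longrightarrow> chart_inv c (snd c p) = p"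
  by (rule chart_inv_eq[OF chart_inj])

lemma chart_inv_at [simp]: "c \<in> charts_at M p \<Longrightarrow> chart_inv c (snd c p) = p"
  by (simp add: charts_at_def chart_inv_chart)

lemma eventually_in_overlap:
  assumes "c \<in> charts_at M p" "d \<in> charts_at M p"
  shows "eventually (\<lambda>x. chart_inv c x \<in> fst c \<inter> fst d \<and> snd c (chart_inv c x) = x) (nhds (snd c p))"
proof -
  have "eventually (\<lambda>x. x \<in> snd c ` (fst c \<inter> fst d)) (nhds (snd c p))"
    using assms open_overlap by (intro eventually_nhds_in_open) (auto simp: charts_at_def)
  then show ?thesis
    by (rule eventually_mono) (use assms in \<open>auto simp: charts_at_def chart_inv_chart\<close>)
qed

lemma change_of_chart:
  assumes c: "c \<in> charts_at M (g x)" and d: "d \<in> charts_at M (g x)"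
    and ev: "eventually (\<lambda>y. g y \<in> fst c) (nhds x)" and g: "(snd c \<circ> g has_derivative g') (at x)"
  shows "(snd d \<circ> g has_derivative (\<lambda>h. fderiv (snd d \<circ> chart_inv c) (snd c (g x)) (g' h))) (at x)"
proof -
  have "((snd d \<circ> chart_inv c) \<circ> (snd c \<circ> g) has_derivative
      fderiv (snd d \<circ> chart_inv c) (snd c (g x)) \<circ> g') (at x)"
    using transition_differentiable[OF c d] g
    by (intro diff_chain_at) (auto simp: has_derivative_fderiv)
  then have "((snd d \<circ> chart_inv c) \<circ> (snd c \<circ> g) has_derivative
      (\<lambda>h. fderiv (snd d \<circ> chart_inv c) (snd c (g x)) (g' h))) (at x)"
    by (simp add: o_def)
  then show ?thesis
  proof (rule has_derivative_cong_eventually)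
    show "\<forall>\<^sub>F y in nhds x. ((snd d \<circ> chart_inv c) \<circ> (snd c \<circ> g)) y = (snd d \<circ> g) y"
      using ev by (rule eventually_mono) (use c in \<open>auto simp: charts_at_def chart_inv_chart\<close>)
  qed
qed

lemma transition_self:
  assumes "c \<in> charts_at M p"
  shows "fderiv (snd c \<circ> chart_inv c) (snd c p) h = h"
proof -
  have "\<forall>\<^sub>F x in nhds (snd c p). (snd c \<circ> chart_inv c) x = id x"
    using eventually_in_overlap[OF assms assms] by (rule eventually_mono) auto
  then have "fderiv (snd c \<circ> chart_inv c) (snd c p) = fderiv id (snd c p)"
    by (rule fderiv_cong_eventually)
  then show ?thesis
    by (simp only: frechet_derivative_id id_apply)
qed

text \<open>
  Coordinate vectors, differentials and velocities are all of the following form, for \<open>g\<close> the inverse of a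
  chart, a map composed with such an inverse, and a curve.
\<close>

lemma directional_derivative_in_tangent_space:
  assumes "g x = p"
    and "\<And>c. c \<in> charts_at M p \<Longrightarrow> eventually (\<lambda>y. g y \<in> fst c) (nhds x)"
    and "\<And>c. c \<in> charts_at M p \<Longrightarrow> (snd c \<circ> g) differentiable (at x)"
  shows "(\<lambda>c. if c \<in> charts_at M p then fderiv (snd c \<circ> g) x h else 0) \<in> tangent_space M p"
proof (rule tangent_spaceI)
  fix c d
  assume cd: "c \<in> charts_at M p" "d \<in> charts_at M p"
  have "(snd c \<circ> g has_derivative fderiv (snd c \<circ> g) x) (at x)"
    by (rule has_derivative_fderiv[OF assms(3)[OF cd(1)]])
  from fun_cong[OF fderiv_eqI[OF change_of_chart[OF _ _ assms(2)[OF cd(1)] this]], of d h]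
  have "fderiv (snd d \<circ> g) x h = fderiv (snd d \<circ> chart_inv c) (snd c p) (fderiv (snd c \<circ> g) x h)"
    using cd assms(1) by simp
  then show "(if d \<in> charts_at M p then fderiv (snd d \<circ> g) x h else 0) =
      fderiv (snd d \<circ> chart_inv c) (snd c p) (if c \<in> charts_at M p then fderiv (snd c \<circ> g) x h else 0)"
    unfolding if_P[OF cd(1)] if_P[OF cd(2)] .
qed simp

lemma tvec_of_coords_in_tangent_space:
  assumes "c \<in> charts_at M p"
  shows "tvec_of_coords M c p x \<in> tangent_space M p"
  unfolding tvec_of_coords_def
proof (rule directional_derivative_in_tangent_space)
  show "eventually (\<lambda>y. chart_inv c y \<in> fst d) (nhds (snd c p))" if "d \<in> charts_at M p" for d
    using eventually_in_overlap[OF assms that] by (rule eventually_mono) auto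
qed (use assms transition_differentiable in auto)

lemma tvec_of_coords_component:
  assumes "c \<in> charts_at M p"
  shows "tvec_of_coords M c p x c = x"
  using assms by (simp add: tvec_of_coords_def transition_self)

lemma tangent_space_eqI:
  assumes "v \<in> tangent_space M p" "w \<in> tangent_space M p" "c \<in> charts_at M p" "v c = w c"
  shows "v = w"
proof
  fix d
  show "v d = w d"
    using tangent_space_transition tangent_space_outside assms by metis
qed

end

definition differentiable_in_charts ::
  "('a, 'e::euclidean_space) mfd \<Rightarrow> ('b, 'f::euclidean_space) mfd \<Rightarrow> ('a \<Rightarrow> 'b) \<Rightarrow> 'a \<Rightarrow> bool" where
  "differentiable_in_charts M N f p \<longleftrightarrow>
     (\<forall>c\<in>charts_at M p. \<forall>d\<in>charts_at N (f p).
        eventually (\<lambda>x. f (chart_inv c x) \<in> fst d) (nhds (snd c p)) \<and>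
        (snd d \<circ> f \<circ> chart_inv c) differentiable (at (snd c p)))"

lemma differentiable_in_charts_D:
  assumes "differentiable_in_charts M N f p" "c \<in> charts_at M p" "d \<in> charts_at N (f p)"
  shows differentiable_in_charts_eventually:
      "eventually (\<lambda>x. f (chart_inv c x) \<in> fst d) (nhds (snd c p))"
    and differentiable_in_charts_has_derivative:
      "(snd d \<circ> f \<circ> chart_inv c has_derivative fderiv (snd d \<circ> f \<circ> chart_inv c) (snd c p)) (at (snd c p))"
  using assms has_derivative_fderiv unfolding differentiable_in_charts_def by blast+

text \<open>
  Any chart \<open>c\<close> may replace the one selected in the definition of the differential: changing it composes the
  coordinate expression of \<open>f\<close> with a transition map, whose derivative also relates the components of \<open>v\<close>.
\<close>

lemma differential_component:
  assumes "differentiable_atlas M" and f: "differentiable_in_charts M N f p"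
    and v: "v \<in> tangent_space M p" and c: "c \<in> charts_at M p" and d: "d \<in> charts_at N (f p)"
  shows "differential M N f p v d = fderiv (snd d \<circ> f \<circ> chart_inv c) (snd c p) (v c)"
proof -
  interpret differentiable_atlas M
    by fact
  define b where "b = (SOME c. c \<in> charts_at M p)"
  have b: "b \<in> charts_at M p"
    unfolding b_def using c by (rule someI)
  have "((snd d \<circ> f \<circ> chart_inv c) \<circ> (snd c \<circ> chart_inv b) has_derivative
      fderiv (snd d \<circ> f \<circ> chart_inv c) (snd c p) \<circ> fderiv (snd c \<circ> chart_inv b) (snd b p)) (at (snd b p))"
    using differentiable_in_charts_has_derivative[OF f c d] b
    by (intro diff_chain_at has_derivative_fderiv transition_differentiable[OF b c]) simp
  then have "(snd d \<circ> f \<circ> chart_inv b has_derivative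
      fderiv (snd d \<circ> f \<circ> chart_inv c) (snd c p) \<circ> fderiv (snd c \<circ> chart_inv b) (snd b p)) (at (snd b p))"
  proof (rule has_derivative_cong_eventually)
    show "\<forall>\<^sub>F x in nhds (snd b p). ((snd d \<circ> f \<circ> chart_inv c) \<circ> (snd c \<circ> chart_inv b)) x
        = (snd d \<circ> f \<circ> chart_inv b) x"
      using eventually_in_overlap[OF b c]
      by (rule eventually_mono) (use c in \<open>auto simp: charts_at_def chart_inv_chart\<close>)
  qed
  from fun_cong[OF fderiv_eqI[OF this], of "v b"]
  have "fderiv (snd d \<circ> f \<circ> chart_inv b) (snd b p) (v b)
      = fderiv (snd d \<circ> f \<circ> chart_inv c) (snd c p) (fderiv (snd c \<circ> chart_inv b) (snd b p) (v b))"
    by simp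
  also have "fderiv (snd c \<circ> chart_inv b) (snd b p) (v b) = v c"
    by (rule tangent_space_transition[OF v b c])
  finally show ?thesis
    unfolding differential_def Let_def b_def[symmetric] if_P[OF d] .
qed

lemma differential_in_tangent_space:
  assumes M: "differentiable_atlas M" and N: "differentiable_atlas N"
    and f: "differentiable_in_charts M N f p"
    and c: "c \<in> charts_at M p" and v: "v \<in> tangent_space M p"
  shows "differential M N f p v \<in> tangent_space N (f p)"
proof -
  interpret M: differentiable_atlas M by fact
  interpret N: differentiable_atlas N by fact
  have "(\<lambda>d. if d \<in> charts_at N (f p) then fderiv (snd d \<circ> (f \<circ> chart_inv c)) (snd c p) (v c) else 0)
      \<in> tangent_space N (f p)"
    using f c unfolding differentiable_in_charts_def
    by (intro N.directional_derivative_in_tangent_space) (auto simp: o_assoc)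
  also have "(\<lambda>d. if d \<in> charts_at N (f p) then fderiv (snd d \<circ> (f \<circ> chart_inv c)) (snd c p) (v c) else 0)
      = differential M N f p v"
    using differential_component[OF M f v c] by (auto simp: differential_def o_assoc Let_def)
  finally show ?thesis .
qed

text \<open>A left inverse has the inverse differential: the chain rule for \<open>g \<circ> f = id\<close>, read in charts.\<close>

lemma differential_left_inverse:
  assumes M: "differentiable_atlas M" and N: "differentiable_atlas N"
    and f: "differentiable_in_charts M N f p" and g: "differentiable_in_charts N M g (f p)"
    and gf: "\<And>q. q \<in> fst c \<Longrightarrow> g (f q) = q"
    and c: "c \<in> charts_at M p" and d: "d \<in> charts_at N (f p)" and v: "v \<in> tangent_space M p"
  shows "differential N M g (f p) (differential M N f p v) = v"
proof -
  interpret M: differentiable_atlas M by fact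
  interpret N: differentiable_atlas N by fact
  have gfp: "g (f p) = p"
    using gf c by (simp add: charts_at_def)
  have w: "differential M N f p v \<in> tangent_space N (f p)"
    by (rule differential_in_tangent_space[OF M N f c v])
  have "((snd c \<circ> g \<circ> chart_inv d) \<circ> (snd d \<circ> f \<circ> chart_inv c) has_derivative
      fderiv (snd c \<circ> g \<circ> chart_inv d) (snd d (f p)) \<circ> fderiv (snd d \<circ> f \<circ> chart_inv c) (snd c p))
      (at (snd c p))"
    using differentiable_in_charts_has_derivative[OF g d, of c] c d gfp
    by (intro diff_chain_at differentiable_in_charts_has_derivative[OF f c d]) simp
  then have "(id has_derivative
      fderiv (snd c \<circ> g \<circ> chart_inv d) (snd d (f p)) \<circ> fderiv (snd d \<circ> f \<circ> chart_inv c) (snd c p))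
      (at (snd c p))"
  proof (rule has_derivative_cong_eventually)
    have "\<forall>\<^sub>F x in nhds (snd c p). f (chart_inv c x) \<in> fst d"
      by (rule differentiable_in_charts_eventually[OF f c d])
    then show "\<forall>\<^sub>F x in nhds (snd c p).
        ((snd c \<circ> g \<circ> chart_inv d) \<circ> (snd d \<circ> f \<circ> chart_inv c)) x = id x"
      using M.eventually_in_overlap[OF c c]
      by eventually_elim (use d gf in \<open>auto simp: charts_at_def N.chart_inv_chart\<close>)
  qed
  from fun_cong[OF fderiv_eqI[OF this], of "v c"]
  have "differential N M g (f p) (differential M N f p v) c = v c"
    using differential_component[OF N g w d, of c] differential_component[OF M f v c d] c gfp by simp
  moreover have "differential N M g (f p) (differential M N f p v) \<in> tangent_space M p"
    using differential_in_tangent_space[OF N M g d w] gfp by simp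
  ultimately show ?thesis
    using M.tangent_space_eqI v c by blast
qed

definition differentiable_curve :: "('a, 'e::euclidean_space) mfd \<Rightarrow> (real \<Rightarrow> 'a) \<Rightarrow> real \<Rightarrow> bool" where
  "differentiable_curve M \<gamma> t \<longleftrightarrow>
     (\<forall>c\<in>charts_at M (\<gamma> t). eventually (\<lambda>s. \<gamma> s \<in> fst c) (nhds t) \<and> (snd c \<circ> \<gamma>) differentiable (at t))"

lemma velocity_in_tangent_space:
  assumes "differentiable_atlas M" and \<gamma>: "differentiable_curve M \<gamma> t"
  shows "velocity M \<gamma> t \<in> tangent_space M (\<gamma> t)"
proof -
  interpret differentiable_atlas M by fact
  have "(\<lambda>c. if c \<in> charts_at M (\<gamma> t) then fderiv (snd c \<circ> \<gamma>) t 1 else 0) \<in> tangent_space M (\<gamma> t)"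
    using \<gamma> unfolding differentiable_curve_def
    by (intro directional_derivative_in_tangent_space) auto
  also have "(\<lambda>c. if c \<in> charts_at M (\<gamma> t) then fderiv (snd c \<circ> \<gamma>) t 1 else 0) = velocity M \<gamma> t"
  proof
    fix c
    show "(if c \<in> charts_at M (\<gamma> t) then fderiv (snd c \<circ> \<gamma>) t 1 else 0) = velocity M \<gamma> t c"
      using \<gamma> fun_cong[OF frechet_derivative_eq_vector_derivative[of "snd c \<circ> \<gamma>" t], of 1]
      unfolding velocity_def differentiable_curve_def by auto
  qed
  finally show ?thesis .
qed

section \<open>Charts of smooth manifolds and of tangent bundles\<close>

lemma smooth_manifold_chart:
  assumes "smooth_manifold M" "c \<in> atlas M"
  shows chart_openin: "openin (mtop M) (fst c)"
    and chart_homeomorphic: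
      "homeomorphic_map (subtopology (mtop M) (fst c)) (top_of_set (snd c ` fst c)) (snd c)"
    and chart_image_open: "open (snd c ` fst c)"
  using assms unfolding smooth_manifold_def by auto

lemma topspace_subtopology_chart:
  assumes "smooth_manifold M" "c \<in> atlas M"
  shows "topspace (subtopology (mtop M) (fst c)) = fst c"
  using openin_subset[OF chart_openin[OF assms]] by auto

lemma chart_inj_on:
  assumes "smooth_manifold M" "c \<in> atlas M"
  shows "inj_on (snd c) (fst c)"
  using homeomorphic_imp_injective_map[OF chart_homeomorphic[OF assms]]
  unfolding topspace_subtopology_chart[OF assms] .

lemma chart_open_image:
  assumes "smooth_manifold M" "c \<in> atlas M" "openin (mtop M) V" "V \<subseteq> fst c"
  shows "open (snd c ` V)"
proof -
  have "openin (subtopology (mtop M) (fst c)) V"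
    using assms(3,4) by (simp add: openin_open_subtopology chart_openin[OF assms(1,2)])
  then have "openin (top_of_set (snd c ` fst c)) (snd c ` V)"
    using homeomorphic_imp_open_map[OF chart_homeomorphic[OF assms(1,2)]] unfolding open_map_def by blast
  then show ?thesis
    using openin_open_trans chart_image_open[OF assms(1,2)] by blast
qed

lemma smooth_transition:
  assumes "smooth_manifold M" "c \<in> atlas M" "d \<in> atlas M"
  shows "smooth_on (snd d \<circ> chart_inv c) (snd c ` (fst c \<inter> fst d))"
  using assms unfolding smooth_manifold_def by blast

lemma smooth_manifold_differentiable_atlas:
  assumes M: "smooth_manifold M"
  shows "differentiable_atlas M"
proof
  show "inj_on (snd c) (fst c)" if "c \<in> atlas M" for c
    by (rule chart_inj_on[OF M that])
  show "open (snd c ` (fst c \<inter> fst d))" if "c \<in> atlas M" "d \<in> atlas M" for c d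
    using chart_open_image[OF M that(1)] chart_openin[OF M] that by (simp add: openin_Int)
  show "(snd d \<circ> chart_inv c) differentiable (at (snd c p))"
    if "c \<in> charts_at M p" "d \<in> charts_at M p" for c d p
    using smooth_on_imp_differentiable[OF smooth_transition[OF M]] that
    by (auto simp: charts_at_def)
qed

lemma charts_at_nonempty:
  assumes "smooth_manifold M" "p \<in> topspace (mtop M)"
  shows "charts_at M p \<noteq> {}"
proof -
  have "(\<Union>c\<in>atlas M. fst c) = topspace (mtop M)"
    using assms unfolding smooth_manifold_def by blast
  then obtain c where "c \<in> atlas M" "p \<in> fst c"
    using assms(2) by blast
  then show ?thesis
    unfolding charts_at_def by blast
qed

lemma mem_natural_chart [simp]:
  "(q, v) \<in> fst (natural_chart M c) \<longleftrightarrow> q \<in> fst c \<and> v \<in> tangent_space M q"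
  by (simp add: natural_chart_def)

lemma natural_chart_apply [simp]: "snd (natural_chart M c) (q, v) = (snd c q, v c)"
  by (simp add: natural_chart_def)

lemma charts_at_tangent_bundle_D:
  assumes "b \<in> charts_at (tangent_bundle M) (q, v)"
  obtains c where "c \<in> charts_at M q" "b = natural_chart M c" "v \<in> tangent_space M q"
  using assms by (auto simp: charts_at_def tangent_bundle_def)

lemma topspace_tangent_bundle:
  assumes "smooth_manifold M"
  shows "topspace (mtop (tangent_bundle M)) = {(q, v). q \<in> topspace (mtop M) \<and> v \<in> tangent_space M q}"
proof -
  have "topspace (mtop M) = (\<Union>c\<in>atlas M. fst c)"
    using assms unfolding smooth_manifold_def by blast
  moreover have "topspace (mtop (tangent_bundle M)) = (\<Union>c\<in>atlas M. fst (natural_chart M c))"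
  proof
    show "(\<Union>c\<in>atlas M. fst (natural_chart M c)) \<subseteq> topspace (mtop (tangent_bundle M))"
    proof
      fix Y
      assume "Y \<in> (\<Union>c\<in>atlas M. fst (natural_chart M c))"
      then obtain c where "c \<in> atlas M" "Y \<in> {Y \<in> fst (natural_chart M c). snd (natural_chart M c) Y \<in> UNIV}"
        by blast
      then show "Y \<in> topspace (mtop (tangent_bundle M))"
        unfolding tangent_bundle_def topology_generated_by_topspace mfd.select_convs
        using open_UNIV by blast
    qed
  qed (auto simp: tangent_bundle_def)
  ultimately show ?thesis
    by (auto simp: natural_chart_def)
qed

context
  fixes M :: "('a, 'e::euclidean_space) mfd"
  assumes M: "smooth_manifold M"
begin

interpretation differentiable_atlas M
  by (rule smooth_manifold_differentiable_atlas[OF M])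

lemma inj_on_natural_chart:
  assumes "c \<in> atlas M"
  shows "inj_on (snd (natural_chart M c)) (fst (natural_chart M c))"
proof (rule inj_onI)
  fix Y Z
  assume YZ: "Y \<in> fst (natural_chart M c)" "Z \<in> fst (natural_chart M c)"
    and eq: "snd (natural_chart M c) Y = snd (natural_chart M c) Z"
  obtain q v q' v' where Y: "Y = (q, v)" and Z: "Z = (q', v')"
    by fastforce
  have "q = q'"
    using YZ eq chart_inj[OF assms] by (auto simp: Y Z dest: inj_onD)
  moreover have "c \<in> charts_at M q"
    using YZ assms by (auto simp: Y charts_at_def)
  ultimately show "Y = Z"
    using YZ eq tangent_space_eqI[of v q v' c] by (auto simp: Y Z)
qed

lemma natural_chart_inv:
  assumes "c \<in> charts_at M q"
  shows "chart_inv (natural_chart M c) (snd c q, w) = (q, tvec_of_coords M c q w)"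
proof -
  have "c \<in> atlas M"
    using assms by (simp add: charts_at_def)
  from chart_inv_eq[OF inj_on_natural_chart[OF this], of "(q, tvec_of_coords M c q w)"]
  show ?thesis
    using assms tvec_of_coords_in_tangent_space[OF assms]
    by (simp add: tvec_of_coords_component charts_at_def)
qed

lemma natural_chart_image:
  assumes "c \<in> atlas M" "V \<subseteq> fst c"
  shows "snd (natural_chart M c) ` {Y \<in> fst (natural_chart M c). fst Y \<in> V} = (snd c ` V) \<times> UNIV"
proof
  show "(snd c ` V) \<times> UNIV \<subseteq> snd (natural_chart M c) ` {Y \<in> fst (natural_chart M c). fst Y \<in> V}"
  proof clarify
    fix q and w :: 'e
    assume q: "q \<in> V"
    then have c: "c \<in> charts_at M q"
      using assms by (auto simp: charts_at_def)
    have "(snd c q, w) = snd (natural_chart M c) (q, tvec_of_coords M c q w)"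
      using c by (simp add: tvec_of_coords_component)
    then show "(snd c q, w) \<in> snd (natural_chart M c) ` {Y \<in> fst (natural_chart M c). fst Y \<in> V}"
      by (rule image_eqI) (use q assms(2) tvec_of_coords_in_tangent_space[OF c] in auto)
  qed
qed auto

lemma natural_transition:
  assumes "z \<in> (snd c ` (fst c \<inter> fst d)) \<times> UNIV" "c \<in> atlas M" "d \<in> atlas M"
  shows "(snd (natural_chart M d) \<circ> chart_inv (natural_chart M c)) z
    = tangent_fun (snd d \<circ> chart_inv c) z"
proof -
  obtain q w where z: "z = (snd c q, w)" and q: "q \<in> fst c" "q \<in> fst d"
    using assms(1) by auto
  then have "c \<in> charts_at M q" "d \<in> charts_at M q"
    using assms by (auto simp: charts_at_def)
  then show ?thesis
    by (simp add: z natural_chart_inv tangent_fun_def tvec_of_coords_def)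
qed

lemma tangent_bundle_differentiable_atlas: "differentiable_atlas (tangent_bundle M)"
proof
  show "inj_on (snd b) (fst b)" if "b \<in> atlas (tangent_bundle M)" for b
    using that inj_on_natural_chart by (auto simp: tangent_bundle_def)
  show "open (snd b ` (fst b \<inter> fst b'))"
    if b: "b \<in> atlas (tangent_bundle M)" "b' \<in> atlas (tangent_bundle M)" for b b'
  proof -
    obtain c d where cd: "c \<in> atlas M" "d \<in> atlas M" "b = natural_chart M c" "b' = natural_chart M d"
      using b by (auto simp: tangent_bundle_def)
    have "fst b \<inter> fst b' = {Y \<in> fst (natural_chart M c). fst Y \<in> fst c \<inter> fst d}"
      by (auto simp: cd)
    then have "snd b ` (fst b \<inter> fst b') = (snd c ` (fst c \<inter> fst d)) \<times> UNIV"
      using natural_chart_image[of c "fst c \<inter> fst d"] cd by simp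
    then show ?thesis
      using open_overlap cd by (simp add: open_Times)
  qed
  show "(snd b' \<circ> chart_inv b) differentiable (at (snd b Y))"
    if b: "b \<in> charts_at (tangent_bundle M) Y" "b' \<in> charts_at (tangent_bundle M) Y" for b b' Y
  proof -
    obtain q v where Y: "Y = (q, v)"
      by fastforce
    obtain c d where cd: "c \<in> charts_at M q" "d \<in> charts_at M q"
      "b = natural_chart M c" "b' = natural_chart M d"
      using b unfolding Y by (elim charts_at_tangent_bundle_D) blast
    have atl: "c \<in> atlas M" "d \<in> atlas M" and q: "snd c q \<in> snd c ` (fst c \<inter> fst d)"
      using cd by (auto simp: charts_at_def)
    note opn = open_overlap[OF atl]
    have "\<forall>\<^sub>F z in nhds (snd c q, v c). z \<in> (snd c ` (fst c \<inter> fst d)) \<times> UNIV"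
      using opn q by (intro eventually_nhds_in_open) (auto simp: open_Times)
    then have "\<forall>\<^sub>F z in nhds (snd c q, v c). tangent_fun (snd d \<circ> chart_inv c) z = (snd b' \<circ> chart_inv b) z"
      by (rule eventually_mono) (use natural_transition atl in \<open>auto simp: cd\<close>)
    from has_derivative_cong_eventually[OF has_derivative_tangent_fun[OF smooth_transition[OF M atl] opn q] this]
    show ?thesis
      unfolding Y cd natural_chart_apply differentiable_def by blast
  qed
qed

end

section \<open>Tangent maps in charts\<close>

context
  fixes M :: "('a, 'e::euclidean_space) mfd" and N :: "('b, 'f::euclidean_space) mfd" and f :: "'a \<Rightarrow> 'b"
  assumes M: "smooth_manifold M" and N: "smooth_manifold N" and f: "smooth_map M N f"
begin

interpretation M: differentiable_atlas M
  by (rule smooth_manifold_differentiable_atlas[OF M])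

lemma smooth_map_chart_domain_open:
  assumes "c \<in> atlas M" "d \<in> atlas N"
  shows "open (snd c ` {p \<in> fst c. f p \<in> fst d})"
proof (rule chart_open_image[OF M assms(1)])
  show "openin (mtop M) {p \<in> fst c. f p \<in> fst d}"
    using f chart_openin[OF M assms(1)] chart_openin[OF N assms(2)]
    by (intro openin_continuous_map_preimage_gen[of "mtop M" "mtop N"]) (auto simp: smooth_map_def)
qed auto

lemma smooth_map_in_charts:
  assumes "c \<in> atlas M" "d \<in> atlas N"
  shows "smooth_on (snd d \<circ> f \<circ> chart_inv c) (snd c ` {p \<in> fst c. f p \<in> fst d})"
  using f assms unfolding smooth_map_def by blast

lemma smooth_map_differentiable_in_charts: "differentiable_in_charts M N f p"
  unfolding differentiable_in_charts_def
proof (intro ballI conjI)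
  fix c d
  assume "c \<in> charts_at M p" "d \<in> charts_at N (f p)"
  then have cd: "c \<in> atlas M" "d \<in> atlas N" "snd c p \<in> snd c ` {p \<in> fst c. f p \<in> fst d}"
    by (auto simp: charts_at_def)
  show "(snd d \<circ> f \<circ> chart_inv c) differentiable (at (snd c p))"
    by (rule smooth_on_imp_differentiable[OF smooth_map_in_charts[OF cd(1,2)] cd(3)])
  have "\<forall>\<^sub>F x in nhds (snd c p). x \<in> snd c ` {p \<in> fst c. f p \<in> fst d}"
    by (rule eventually_nhds_in_open[OF smooth_map_chart_domain_open[OF cd(1,2)] cd(3)])
  then show "\<forall>\<^sub>F x in nhds (snd c p). f (chart_inv c x) \<in> fst d"
    by (rule eventually_mono) (use cd in \<open>auto simp: M.chart_inv_chart\<close>)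
qed

lemma tangent_map_in_natural_charts:
  assumes c: "c \<in> charts_at M q" and d: "d \<in> charts_at N (f q)" and v: "v \<in> tangent_space M q"
  shows "snd (natural_chart N d) (tangent_map M N f (q, v)) = tangent_fun (snd d \<circ> f \<circ> chart_inv c) (snd c q, v c)"
  using differential_component[OF M.differentiable_atlas_axioms smooth_map_differentiable_in_charts v c d] c
  by (simp add: tangent_map_def tangent_fun_def)

lemma tangent_map_mem_natural_chart:
  assumes c: "c \<in> charts_at M q" and d: "f q \<in> fst d" and v: "v \<in> tangent_space M q"
  shows "tangent_map M N f (q, v) \<in> fst (natural_chart N d)"
  using differential_in_tangent_space[OF M.differentiable_atlas_axioms
      smooth_manifold_differentiable_atlas[OF N] smooth_map_differentiable_in_charts c v] d
  by (simp add: tangent_map_def)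

lemma tangent_map_in_coordinates:
  assumes z: "z \<in> (snd c ` {p \<in> fst c. f p \<in> fst d}) \<times> UNIV" and cd: "c \<in> atlas M" "d \<in> atlas N"
  shows "(snd (natural_chart N d) \<circ> tangent_map M N f \<circ> chart_inv (natural_chart M c)) z
      = tangent_fun (snd d \<circ> f \<circ> chart_inv c) z"
    and "tangent_map M N f (chart_inv (natural_chart M c) z) \<in> fst (natural_chart N d)"
proof -
  obtain q w where z: "z = (snd c q, w)" and q: "q \<in> fst c" "f q \<in> fst d"
    using z by auto
  then have c: "c \<in> charts_at M q" and d: "d \<in> charts_at N (f q)"
    using cd by (auto simp: charts_at_def)
  note v = M.tvec_of_coords_in_tangent_space[OF c, of w]
  show "(snd (natural_chart N d) \<circ> tangent_map M N f \<circ> chart_inv (natural_chart M c)) z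
      = tangent_fun (snd d \<circ> f \<circ> chart_inv c) z"
    using tangent_map_in_natural_charts[OF c d v]
    by (simp add: z natural_chart_inv[OF M c] M.tvec_of_coords_component[OF c])
  show "tangent_map M N f (chart_inv (natural_chart M c) z) \<in> fst (natural_chart N d)"
    using tangent_map_mem_natural_chart[OF c q(2) v] by (simp add: z natural_chart_inv[OF M c])
qed

lemma tangent_map_chart_has_derivative:
  assumes c: "c \<in> charts_at M q" and d: "d \<in> charts_at N (f q)"
  defines "F \<equiv> snd d \<circ> f \<circ> chart_inv c"
  shows "(snd (natural_chart N d) \<circ> tangent_map M N f \<circ> chart_inv (natural_chart M c) has_derivative
      (\<lambda>h. (fderiv F (snd c q) (fst h), fderiv2 F (snd c q) (fst h) x + fderiv F (snd c q) (snd h))))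
      (at (snd c q, x))"
    and "\<forall>\<^sub>F z in nhds (snd c q, x).
      tangent_map M N f (chart_inv (natural_chart M c) z) \<in> fst (natural_chart N d)"
proof -
  define U where "U = snd c ` {p \<in> fst c. f p \<in> fst d}"
  have cd: "c \<in> atlas M" "d \<in> atlas N" and q: "snd c q \<in> U"
    using c d by (auto simp: charts_at_def U_def)
  have U: "open U"
    unfolding U_def by (rule smooth_map_chart_domain_open[OF cd])
  have F: "smooth_on F U"
    unfolding F_def U_def by (rule smooth_map_in_charts[OF cd])
  have ev: "\<forall>\<^sub>F z in nhds (snd c q, x). z \<in> U \<times> UNIV"
    using U q by (intro eventually_nhds_in_open) (auto simp: open_Times)
  show "\<forall>\<^sub>F z in nhds (snd c q, x).
      tangent_map M N f (chart_inv (natural_chart M c) z) \<in> fst (natural_chart N d)"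
    using ev by (rule eventually_mono) (use tangent_map_in_coordinates(2)[OF _ cd] U_def in blast)
  show "(snd (natural_chart N d) \<circ> tangent_map M N f \<circ> chart_inv (natural_chart M c) has_derivative
      (\<lambda>h. (fderiv F (snd c q) (fst h), fderiv2 F (snd c q) (fst h) x + fderiv F (snd c q) (snd h))))
      (at (snd c q, x))"
  proof (rule has_derivative_cong_eventually[OF has_derivative_tangent_fun[OF F U q]])
    show "\<forall>\<^sub>F z in nhds (snd c q, x). tangent_fun F z
      = (snd (natural_chart N d) \<circ> tangent_map M N f \<circ> chart_inv (natural_chart M c)) z"
      using ev by (rule eventually_mono) (unfold U_def F_def, rule tangent_map_in_coordinates(1)[OF _ cd, symmetric])
  qed
qed

lemma tangent_map_differentiable_in_charts:
  "differentiable_in_charts (tangent_bundle M) (tangent_bundle N) (tangent_map M N f) Y"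
  unfolding differentiable_in_charts_def
proof (intro ballI)
  fix b e
  assume b: "b \<in> charts_at (tangent_bundle M) Y"
    and e: "e \<in> charts_at (tangent_bundle N) (tangent_map M N f Y)"
  obtain q v where Y: "Y = (q, v)"
    by fastforce
  obtain c where c: "c \<in> charts_at M q" "b = natural_chart M c"
    using b unfolding Y by (elim charts_at_tangent_bundle_D)
  obtain d where d: "d \<in> charts_at N (f q)" "e = natural_chart N d"
    using e unfolding Y tangent_map_def by (auto elim!: charts_at_tangent_bundle_D)
  show "(\<forall>\<^sub>F x in nhds (snd b Y). tangent_map M N f (chart_inv b x) \<in> fst e) \<and>
      (snd e \<circ> tangent_map M N f \<circ> chart_inv b) differentiable (at (snd b Y))"
    using tangent_map_chart_has_derivative[OF c(1) d(1), of "v c"]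
    unfolding Y c(2) d(2) natural_chart_apply differentiable_def by blast
qed

end

section \<open>Smooth curves and their lifts\<close>

lemma smooth_curve_iff:
  assumes S: "open S" and open_charts: "\<forall>d\<in>atlas M. openin (mtop M) (fst d)"
  shows "smooth_map (open_mfd S) M \<gamma> \<longleftrightarrow> continuous_map (top_of_set S) (mtop M) \<gamma> \<and>
    (\<forall>d\<in>atlas M. smooth_on (snd d \<circ> \<gamma>) {t \<in> S. \<gamma> t \<in> fst d})"
proof -
  have "smooth_on (snd d \<circ> \<gamma> \<circ> inv_into S id) {t \<in> S. \<gamma> t \<in> fst d}
      \<longleftrightarrow> smooth_on (snd d \<circ> \<gamma>) {t \<in> S. \<gamma> t \<in> fst d}"
    if "continuous_map (top_of_set S) (mtop M) \<gamma>" "d \<in> atlas M" for d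
  proof -
    have "openin (top_of_set S) {t \<in> S. \<gamma> t \<in> fst d}"
      using openin_continuous_map_preimage[OF that(1) open_charts[rule_format, OF that(2)]] by simp
    then have opn: "open {t \<in> S. \<gamma> t \<in> fst d}"
      using S openin_open_trans by blast
    have inv: "inv_into S id t = t" if "t \<in> S" for t
      using inv_into_f_f[of id S t] that by simp
    show ?thesis
    proof
      assume "smooth_on (snd d \<circ> \<gamma> \<circ> inv_into S id) {t \<in> S. \<gamma> t \<in> fst d}"
      then show "smooth_on (snd d \<circ> \<gamma>) {t \<in> S. \<gamma> t \<in> fst d}"
        by (rule smooth_on_cong[OF opn, rotated]) (simp add: inv)
    next
      assume "smooth_on (snd d \<circ> \<gamma>) {t \<in> S. \<gamma> t \<in> fst d}"
      then show "smooth_on (snd d \<circ> \<gamma> \<circ> inv_into S id) {t \<in> S. \<gamma> t \<in> fst d}"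
        by (rule smooth_on_cong[OF opn, rotated]) (simp add: inv)
    qed
  qed
  then show ?thesis
    by (auto simp: smooth_map_def open_mfd_def chart_inv_def)
qed

lemma charts_openin: "smooth_manifold M \<Longrightarrow> \<forall>d\<in>atlas M. openin (mtop M) (fst d)"
  using chart_openin by blast

lemma smooth_curve_chart_domain_open:
  assumes S: "open S" and "continuous_map (top_of_set S) (mtop M) \<gamma>" "openin (mtop M) V"
  shows "open {t \<in> S. \<gamma> t \<in> V}"
proof -
  have "openin (top_of_set S) {t \<in> S. \<gamma> t \<in> V}"
    using openin_continuous_map_preimage[OF assms(2,3)] by simp
  then show ?thesis
    using S openin_open_trans by blast
qed

lemma smooth_curve_differentiable:
  assumes S: "open S" and open_charts: "\<forall>d\<in>atlas M. openin (mtop M) (fst d)"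
    and \<gamma>: "smooth_map (open_mfd S) M \<gamma>" and t: "t \<in> S"
  shows "differentiable_curve M \<gamma> t"
  unfolding differentiable_curve_def
proof (intro ballI conjI)
  fix c
  assume "c \<in> charts_at M (\<gamma> t)"
  then have c: "c \<in> atlas M" and tc: "t \<in> {t \<in> S. \<gamma> t \<in> fst c}"
    using t by (auto simp: charts_at_def)
  have \<gamma>': "continuous_map (top_of_set S) (mtop M) \<gamma>" "smooth_on (snd c \<circ> \<gamma>) {t \<in> S. \<gamma> t \<in> fst c}"
    using \<gamma> c unfolding smooth_curve_iff[OF S open_charts] by auto
  show "(snd c \<circ> \<gamma>) differentiable (at t)"
    by (rule smooth_on_imp_differentiable[OF \<gamma>'(2) tc])
  have "\<forall>\<^sub>F s in nhds t. s \<in> {t \<in> S. \<gamma> t \<in> fst c}"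
    by (rule eventually_nhds_in_open[OF smooth_curve_chart_domain_open[OF S \<gamma>'(1) open_charts[rule_format, OF c]] tc])
  then show "\<forall>\<^sub>F s in nhds t. \<gamma> s \<in> fst c"
    by (rule eventually_mono) auto
qed

lemma natural_chart_preimage_openin:
  assumes "c \<in> atlas M" "open W"
  shows "openin (mtop (tangent_bundle M)) {Y \<in> fst (natural_chart M c). snd (natural_chart M c) Y \<in> W}"
  unfolding tangent_bundle_def mfd.select_convs
  by (rule topology_generated_by_Basis) (use assms in blast)

lemma natural_charts_openin: "\<forall>b\<in>atlas (tangent_bundle M). openin (mtop (tangent_bundle M)) (fst b)"
  using natural_chart_preimage_openin[of _ M UNIV] by (auto simp: tangent_bundle_def)

lemma continuous_map_into_tangent_bundle:
  assumes "\<And>c W. c \<in> atlas M \<Longrightarrow> open W \<Longrightarrow>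
      openin X {t \<in> topspace X. f t \<in> fst (natural_chart M c) \<and> snd (natural_chart M c) (f t) \<in> W}"
    and "\<And>t. t \<in> topspace X \<Longrightarrow> \<exists>c\<in>atlas M. f t \<in> fst (natural_chart M c)"
  shows "continuous_map X (mtop (tangent_bundle M)) f"
  unfolding tangent_bundle_def mfd.select_convs
proof (rule continuous_on_generated_topo)
  fix V
  assume "V \<in> {{Y \<in> fst (natural_chart M c). snd (natural_chart M c) Y \<in> W} |c W. c \<in> atlas M \<and> open W}"
  then obtain c W where cW: "c \<in> atlas M" "open W"
    and V: "V = {Y \<in> fst (natural_chart M c). snd (natural_chart M c) Y \<in> W}"
    by blast
  have "f -` V \<inter> topspace X
      = {t \<in> topspace X. f t \<in> fst (natural_chart M c) \<and> snd (natural_chart M c) (f t) \<in> W}"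
    by (auto simp: V)
  then show "openin X (f -` V \<inter> topspace X)"
    using assms(1)[OF cW] by simp
next
  show "f ` topspace X
      \<subseteq> \<Union> {{Y \<in> fst (natural_chart M c). snd (natural_chart M c) Y \<in> W} |c W. c \<in> atlas M \<and> open W}"
  proof
    fix Y
    assume "Y \<in> f ` topspace X"
    then obtain c where "c \<in> atlas M" "Y \<in> {Y \<in> fst (natural_chart M c). snd (natural_chart M c) Y \<in> UNIV}"
      using assms(2) by blast
    then show "Y \<in> \<Union> {{Y \<in> fst (natural_chart M c). snd (natural_chart M c) Y \<in> W} |c W. c \<in> atlas M \<and> open W}"
      using open_UNIV by blast
  qed
qed

lemma continuous_map_tangent_bundle_base:
  fixes M :: "('a, 'e::euclidean_space) mfd"
  assumes M: "smooth_manifold M"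
  shows "continuous_map (mtop (tangent_bundle M)) (mtop M) fst"
  unfolding continuous_map_def
proof (intro conjI allI impI)
  show "fst \<in> topspace (mtop (tangent_bundle M)) \<rightarrow> topspace (mtop M)"
    by (auto simp: topspace_tangent_bundle[OF M])
  fix V
  assume V: "openin (mtop M) V"
  show "openin (mtop (tangent_bundle M)) {Y \<in> topspace (mtop (tangent_bundle M)). fst Y \<in> V}"
  proof (subst openin_subopen, intro ballI)
    fix Y
    assume Y: "Y \<in> {Y \<in> topspace (mtop (tangent_bundle M)). fst Y \<in> V}"
    then obtain q v where qv: "Y = (q, v)" "q \<in> V" "q \<in> topspace (mtop M)" "v \<in> tangent_space M q"
      by (auto simp: topspace_tangent_bundle[OF M])
    obtain c where c: "c \<in> atlas M" "q \<in> fst c"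
      using charts_at_nonempty[OF M qv(3)] by (auto simp: charts_at_def)
    define W where "W = (snd c ` (V \<inter> fst c)) \<times> (UNIV :: 'e set)"
    define T where "T = {Y \<in> fst (natural_chart M c). snd (natural_chart M c) Y \<in> W}"
    have "open W"
      unfolding W_def using chart_open_image[OF M c(1) openin_Int[OF V chart_openin[OF M c(1)]]]
      by (simp add: open_Times)
    then have "openin (mtop (tangent_bundle M)) T"
      unfolding T_def by (rule natural_chart_preimage_openin[OF c(1)])
    moreover have "Y \<in> T"
      using qv c by (auto simp: T_def W_def)
    moreover have "T \<subseteq> {Y \<in> topspace (mtop (tangent_bundle M)). fst Y \<in> V}"
    proof
      fix Z
      assume Z: "Z \<in> T"
      then have "Z \<in> topspace (mtop (tangent_bundle M))"
        using openin_subset \<open>openin (mtop (tangent_bundle M)) T\<close> by blast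
      moreover have "fst Z \<in> V"
        using Z inj_onD[OF chart_inj_on[OF M c(1)]] by (cases Z) (auto simp: T_def W_def)
      ultimately show "Z \<in> {Y \<in> topspace (mtop (tangent_bundle M)). fst Y \<in> V}"
        by simp
    qed
    ultimately show "\<exists>T. openin (mtop (tangent_bundle M)) T \<and> Y \<in> T \<and>
        T \<subseteq> {Y \<in> topspace (mtop (tangent_bundle M)). fst Y \<in> V}"
      by blast
  qed
qed

lemma smooth_map_base_curve:
  assumes M: "smooth_manifold M" and S: "open S" and \<Gamma>: "smooth_map (open_mfd S) (tangent_bundle M) \<Gamma>"
  shows "smooth_map (open_mfd S) M (fst \<circ> \<Gamma>)"
  unfolding smooth_curve_iff[OF S charts_openin[OF M]]
proof (intro conjI ballI)
  have cont: "continuous_map (top_of_set S) (mtop (tangent_bundle M)) \<Gamma>"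
    and smooth: "\<And>b. b \<in> atlas (tangent_bundle M) \<Longrightarrow> smooth_on (snd b \<circ> \<Gamma>) {t \<in> S. \<Gamma> t \<in> fst b}"
    using \<Gamma> unfolding smooth_curve_iff[OF S natural_charts_openin] by auto
  show "continuous_map (top_of_set S) (mtop M) (fst \<circ> \<Gamma>)"
    by (rule continuous_map_compose[OF cont continuous_map_tangent_bundle_base[OF M]])
  fix d
  assume d: "d \<in> atlas M"
  then have b: "natural_chart M d \<in> atlas (tangent_bundle M)"
    by (simp add: tangent_bundle_def)
  have "\<Gamma> t \<in> topspace (mtop (tangent_bundle M))" if "t \<in> S" for t
    using continuous_map_funspace[OF cont] that by auto
  then have "{t \<in> S. (fst \<circ> \<Gamma>) t \<in> fst d} = {t \<in> S. \<Gamma> t \<in> fst (natural_chart M d)}"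
    by (fastforce simp: topspace_tangent_bundle[OF M] natural_chart_def)
  moreover have "smooth_on (\<lambda>t. fst ((snd (natural_chart M d) \<circ> \<Gamma>) t)) {t \<in> S. \<Gamma> t \<in> fst (natural_chart M d)}"
    by (rule smooth_on_linear_comp[OF smooth_curve_chart_domain_open[OF S cont natural_charts_openin[rule_format, OF b]]
          bounded_linear_fst smooth[OF b]])
  moreover have "(\<lambda>t. fst ((snd (natural_chart M d) \<circ> \<Gamma>) t)) = snd d \<circ> (fst \<circ> \<Gamma>)"
    by (auto simp: natural_chart_def split: prod.split)
  ultimately show "smooth_on (snd d \<circ> (fst \<circ> \<Gamma>)) {t \<in> S. (fst \<circ> \<Gamma>) t \<in> fst d}"
    by simp
qed

lemma curve_lift_mem_natural_chart:
  assumes M: "smooth_manifold M" and S: "open S" and \<gamma>: "smooth_map (open_mfd S) M \<gamma>" and t: "t \<in> S"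
  shows "curve_lift M \<gamma> t \<in> fst (natural_chart M c) \<longleftrightarrow> \<gamma> t \<in> fst c"
  using velocity_in_tangent_space[OF smooth_manifold_differentiable_atlas[OF M]
      smooth_curve_differentiable[OF S charts_openin[OF M] \<gamma> t]]
  by (simp add: curve_lift_def)

lemma curve_lift_in_natural_chart:
  assumes M: "smooth_manifold M" and S: "open S" and \<gamma>: "smooth_map (open_mfd S) M \<gamma>" and t: "t \<in> S"
    and c: "c \<in> atlas M" "\<gamma> t \<in> fst c"
  shows "snd (natural_chart M c) (curve_lift M \<gamma> t) = (snd c (\<gamma> t), fderiv (snd c \<circ> \<gamma>) t 1)"
proof -
  have c': "c \<in> charts_at M (\<gamma> t)"
    using c by (simp add: charts_at_def)
  then have "(snd c \<circ> \<gamma>) differentiable (at t)"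
    using smooth_curve_differentiable[OF S charts_openin[OF M] \<gamma> t] by (simp add: differentiable_curve_def)
  then show ?thesis
    using c' by (simp add: curve_lift_def velocity_def frechet_derivative_eq_vector_derivative)
qed

text \<open>
  A natural chart lists the coordinates of the base point first, so the first half of the velocity of a curve in
  the tangent bundle differentiates the coordinates of its base curve.
\<close>

lemma velocity_in_natural_chart:
  assumes S: "open S" and \<Gamma>: "smooth_map (open_mfd S) (tangent_bundle M) \<Gamma>" and t: "t \<in> S"
    and c: "c \<in> atlas M" and mem: "\<Gamma> t \<in> fst (natural_chart M c)"
  shows "(snd (natural_chart M c) \<circ> \<Gamma> has_vector_derivative
      velocity (tangent_bundle M) \<Gamma> t (natural_chart M c)) (at t)"
    and "fst (velocity (tangent_bundle M) \<Gamma> t (natural_chart M c)) = velocity M (fst \<circ> \<Gamma>) t c"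
proof -
  have chart: "natural_chart M c \<in> charts_at (tangent_bundle M) (\<Gamma> t)"
    using c mem by (simp add: charts_at_def tangent_bundle_def)
  then have "(snd (natural_chart M c) \<circ> \<Gamma>) differentiable (at t)"
    using smooth_curve_differentiable[OF S natural_charts_openin \<Gamma> t] by (simp add: differentiable_curve_def)
  then show D: "(snd (natural_chart M c) \<circ> \<Gamma> has_vector_derivative
      velocity (tangent_bundle M) \<Gamma> t (natural_chart M c)) (at t)"
    using chart by (simp add: velocity_def vector_derivative_works)
  have "((\<lambda>s. fst ((snd (natural_chart M c) \<circ> \<Gamma>) s)) has_vector_derivative
      fst (velocity (tangent_bundle M) \<Gamma> t (natural_chart M c))) (at t)"
    by (rule bounded_linear.has_vector_derivative[OF bounded_linear_fst D])
  moreover have "(\<lambda>s. fst ((snd (natural_chart M c) \<circ> \<Gamma>) s)) = snd c \<circ> (fst \<circ> \<Gamma>)"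
    by (auto simp: natural_chart_def split: prod.split)
  ultimately have "vector_derivative (snd c \<circ> (fst \<circ> \<Gamma>)) (at t)
      = fst (velocity (tangent_bundle M) \<Gamma> t (natural_chart M c))"
    using vector_derivative_at by metis
  moreover have "c \<in> charts_at M ((fst \<circ> \<Gamma>) t)"
    using c mem by (auto simp: charts_at_def natural_chart_def)
  ultimately show "fst (velocity (tangent_bundle M) \<Gamma> t (natural_chart M c)) = velocity M (fst \<circ> \<Gamma>) t c"
    by (simp add: velocity_def)
qed

lemma base_of_curve_lift: "fst \<circ> curve_lift M \<gamma> = \<gamma>"
  by (auto simp: curve_lift_def)

lemma smooth_map_curve_lift:
  assumes M: "smooth_manifold M" and S: "open S" and \<gamma>: "smooth_map (open_mfd S) M \<gamma>"
  shows "smooth_map (open_mfd S) (tangent_bundle M) (curve_lift M \<gamma>)"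
proof -
  have cont: "continuous_map (top_of_set S) (mtop M) \<gamma>"
    and smooth: "\<And>d. d \<in> atlas M \<Longrightarrow> smooth_on (snd d \<circ> \<gamma>) {t \<in> S. \<gamma> t \<in> fst d}"
    using \<gamma> unfolding smooth_curve_iff[OF S charts_openin[OF M]] by auto
  have dom: "{t \<in> S. curve_lift M \<gamma> t \<in> fst (natural_chart M c)} = {t \<in> S. \<gamma> t \<in> fst c}" for c
    using curve_lift_mem_natural_chart[OF M S \<gamma>] by blast
  have opn: "open {t \<in> S. \<gamma> t \<in> fst c}" if "c \<in> atlas M" for c
    by (rule smooth_curve_chart_domain_open[OF S cont chart_openin[OF M that]])
  have smooth_lift: "smooth_on (snd (natural_chart M c) \<circ> curve_lift M \<gamma>) {t \<in> S. \<gamma> t \<in> fst c}"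
    if c: "c \<in> atlas M" for c
  proof (rule smooth_on_cong[OF opn[OF c]])
    show "smooth_on (\<lambda>t. ((snd c \<circ> \<gamma>) t, fderiv (snd c \<circ> \<gamma>) t 1)) {t \<in> S. \<gamma> t \<in> fst c}"
      by (intro smooth_on_Pair opn[OF c] smooth[OF c] smooth_on_fderiv)
    show "((snd c \<circ> \<gamma>) t, fderiv (snd c \<circ> \<gamma>) t 1) = (snd (natural_chart M c) \<circ> curve_lift M \<gamma>) t"
      if "t \<in> {t \<in> S. \<gamma> t \<in> fst c}" for t
      using curve_lift_in_natural_chart[OF M S \<gamma> _ c] that by simp
  qed
  show ?thesis
    unfolding smooth_curve_iff[OF S natural_charts_openin]
  proof (intro conjI ballI)
    fix b
    assume "b \<in> atlas (tangent_bundle M)"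
    then obtain c where "c \<in> atlas M" "b = natural_chart M c"
      by (auto simp: tangent_bundle_def)
    then show "smooth_on (snd b \<circ> curve_lift M \<gamma>) {t \<in> S. curve_lift M \<gamma> t \<in> fst b}"
      using smooth_lift dom by simp
  next
    show "continuous_map (top_of_set S) (mtop (tangent_bundle M)) (curve_lift M \<gamma>)"
    proof (rule continuous_map_into_tangent_bundle)
      fix c and W :: "('b \<times> 'b) set"
      assume c: "c \<in> atlas M" and W: "open W"
      have "open ((snd (natural_chart M c) \<circ> curve_lift M \<gamma>) -` W \<inter> {t \<in> S. \<gamma> t \<in> fst c})"
        using continuous_on_open_vimage[OF opn[OF c]] smooth_on_imp_continuous_on[OF smooth_lift[OF c]] W
        by blast
      also have "(snd (natural_chart M c) \<circ> curve_lift M \<gamma>) -` W \<inter> {t \<in> S. \<gamma> t \<in> fst c} =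
          {t \<in> topspace (top_of_set S). curve_lift M \<gamma> t \<in> fst (natural_chart M c)
            \<and> snd (natural_chart M c) (curve_lift M \<gamma> t) \<in> W}" (is "_ = ?T")
        using dom[of c] by auto
      finally show "openin (top_of_set S) ?T"
        by (simp add: openin_open_eq[OF S])
    next
      fix t
      assume "t \<in> topspace (top_of_set S)"
      then have t: "t \<in> S"
        by simp
      then have "\<gamma> t \<in> topspace (mtop M)"
        using continuous_map_funspace[OF cont] by auto
      then obtain c where "c \<in> atlas M" "\<gamma> t \<in> fst c"
        using charts_at_nonempty[OF M] unfolding charts_at_def by blast
      then show "\<exists>c\<in>atlas M. curve_lift M \<gamma> t \<in> fst (natural_chart M c)"
        using curve_lift_mem_natural_chart[OF M S \<gamma> t] by blast
    qed
  qed
qed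

section \<open>Raising indices\<close>

text \<open>
  In a finite-dimensional tangent space a nondegenerate form is a bijection onto the covectors, so an equation
  with \<open>\<sharp>\<close> can be rewritten as a weak form tested against all tangent vectors.
\<close>

lemma sharp_eq_iff:
  fixes M :: "('a, 'e::euclidean_space) mfd" and B :: "'e \<Rightarrow> 'e \<Rightarrow> real"
  assumes "differentiable_atlas M" and c: "c \<in> charts_at M p"
    and \<tau>: "\<And>u w. u \<in> tangent_space M p \<Longrightarrow> w \<in> tangent_space M p \<Longrightarrow> \<tau> p u w = B (u c) (w c)"
    and B: "\<And>w. linear (\<lambda>u. B u w)" "\<And>u. linear (\<lambda>w. B u w)"
    and nondeg: "\<And>w. w \<in> tangent_space M p \<Longrightarrow> (\<forall>u\<in>tangent_space M p. \<tau> p u w = 0) \<Longrightarrow> w = (\<lambda>_. 0)"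
    and \<mu>: "\<And>u. u \<in> tangent_space M p \<Longrightarrow> \<mu> u = l (u c)" and l: "linear l"
    and w: "w \<in> tangent_space M p"
  shows "w = sharp M \<tau> p (restrict \<mu> (tangent_space M p)) \<longleftrightarrow> (\<forall>u. B u (w c) = l u)"
proof -
  interpret differentiable_atlas M by fact
  let ?T = "tangent_space M p"
  note vec = tvec_of_coords_in_tangent_space[OF c]
  note comp = tvec_of_coords_component[OF c]
  have nondeg_B: "x = 0" if x: "\<And>y. B y x = 0" for x
  proof -
    have "tvec_of_coords M c p x = (\<lambda>_. 0)"
      using vec \<tau> comp x by (intro nondeg) auto
    then show ?thesis
      using comp[of x] by simp
  qed
  obtain y where y: "\<And>u. B u y = l u"
    using nondegenerate_bilinear_represents[OF B nondeg_B l] by blast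
  have inj: "inj_on (flat M \<tau> p) ?T"
  proof (rule inj_onI)
    fix w1 w2
    assume w12: "w1 \<in> ?T" "w2 \<in> ?T" and eq: "flat M \<tau> p w1 = flat M \<tau> p w2"
    have "B u (w1 c - w2 c) = 0" for u
      using fun_cong[OF eq, of "tvec_of_coords M c p u"] vec w12
      by (simp add: flat_def \<tau> comp linear_diff[OF B(2)])
    then show "w1 = w2"
      using nondeg_B[of "w1 c - w2 c"] tangent_space_eqI[OF w12 c] by simp
  qed
  have "flat M \<tau> p (tvec_of_coords M c p y) = restrict \<mu> ?T"
    unfolding flat_def by (rule restrict_ext) (simp add: \<tau> vec comp y \<mu>)
  then have "sharp M \<tau> p (restrict \<mu> ?T) = tvec_of_coords M c p y"
    unfolding sharp_def using inv_into_f_f[OF inj vec[of y]] by simp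
  moreover have "w = tvec_of_coords M c p y \<longleftrightarrow> w c = y"
    using tangent_space_eqI[OF w vec c] comp by metis
  moreover have "w c = y \<longleftrightarrow> (\<forall>u. B u (w c) = l u)"
  proof
    assume "\<forall>u. B u (w c) = l u"
    then have "B u (w c - y) = 0" for u
      by (simp add: linear_diff[OF B(2)] y)
    then show "w c = y"
      using nondeg_B[of "w c - y"] by simp
  qed (simp add: y)
  ultimately show ?thesis
    by simp
qed

section \<open>Lagrangians in natural charts\<close>

lemma chart_partial_twice:
  assumes inj: "inj_on (snd C) (fst C)" and opn: "open (snd C ` fst C)" and Y: "Y \<in> fst C"
  shows "chart_partial C a (chart_partial C b f) Y = fderiv2 (f \<circ> chart_inv C) (snd C Y) a b"
proof -
  have "\<forall>\<^sub>F z in nhds (snd C Y). z \<in> snd C ` fst C"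
    using opn Y by (intro eventually_nhds_in_open) auto
  then have "\<forall>\<^sub>F z in nhds (snd C Y). (chart_partial C b f \<circ> chart_inv C) z = fderiv (f \<circ> chart_inv C) z b"
    by (rule eventually_mono) (auto simp: chart_partial_def chart_inv_eq[OF inj])
  from fun_cong[OF fderiv_cong_eventually[OF this], of a] show ?thesis
    unfolding chart_partial_def[of C a "chart_partial C b f"] .
qed

lemma linear_axis_sum:
  fixes l :: "real^'n \<Rightarrow> real"
  assumes "linear l"
  shows "l x = (\<Sum>i\<in>UNIV. x $ i * l (axis i 1))"
proof -
  have "l x = l (\<Sum>i\<in>UNIV. (x $ i) *\<^sub>R axis i 1)"
    using basis_expansion[of x] by (simp add: scalar_mult_eq_scaleR)
  then show ?thesis
    by (simp add: linear_sum[OF assms] linear_cmul[OF assms])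
qed

lemma bilinear_axis_sum:
  fixes h :: "real^'n \<Rightarrow> real^'m \<Rightarrow> real"
  assumes "\<And>b. linear (\<lambda>a. h a b)" "\<And>a. linear (h a)"
  shows "(\<Sum>i\<in>UNIV. \<Sum>j\<in>UNIV. h (axis i 1) (axis j 1) * a $ i * b $ j) = h a b"
proof -
  have "h a b = (\<Sum>i\<in>UNIV. a $ i * h (axis i 1) b)"
    by (rule linear_axis_sum[OF assms(1)])
  also have "\<dots> = (\<Sum>i\<in>UNIV. \<Sum>j\<in>UNIV. h (axis i 1) (axis j 1) * a $ i * b $ j)"
    by (subst linear_axis_sum[OF assms(2)]) (simp add: sum_distrib_left mult_ac)
  finally show ?thesis
    by simp
qed

lemma bilinear_matrix_vector:
  fixes h :: "real^'n \<Rightarrow> real^'m \<Rightarrow> real"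
  assumes "\<And>a. linear (h a)" "\<And>i j. H $ i $ j = h (axis i 1) (axis j 1)"
  shows "(H *v b) $ i = h (axis i 1) b"
  using linear_axis_sum[OF assms(1), of "axis i 1" b] assms(2)
  by (simp add: matrix_vector_mult_def mult.commute)

lemma invertible_imp_nondegenerate:
  fixes h :: "real^'n \<Rightarrow> real^'n \<Rightarrow> real"
  assumes lin: "\<And>a. linear (h a)" and H: "\<And>i j. H $ i $ j = h (axis i 1) (axis j 1)"
    and inv: "invertible H" and zero: "\<And>a. h a b = 0"
  shows "b = 0"
proof -
  have "H *v b = 0"
    using bilinear_matrix_vector[of h H b, OF lin H] zero by (simp add: vec_eq_iff)
  moreover obtain H' where "H' ** H = mat 1"
    using inv unfolding invertible_def by blast
  ultimately show ?thesis
    by (metis matrix_vector_mul_assoc matrix_vector_mul_lid matrix_vector_mult_0_right)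
qed

lemma matrix_inv_vector_mult:
  fixes H :: "real^'n^'n"
  assumes "invertible H"
  shows "H *v (matrix_inv H *v b) = b"
proof -
  have "H ** matrix_inv H = mat 1"
    using assms unfolding invertible_def matrix_inv_def by (rule someI2_ex) blast
  then show ?thesis
    by (simp add: matrix_vector_mul_assoc)
qed

lemma natural_chart_image_eq:
  assumes "smooth_manifold M" "c \<in> atlas M"
  shows "snd (natural_chart M c) ` fst (natural_chart M c) = (snd c ` fst c) \<times> UNIV"
proof -
  have "{Y \<in> fst (natural_chart M c). fst Y \<in> fst c} = fst (natural_chart M c)"
    by auto
  then show ?thesis
    using natural_chart_image[OF assms(1,2) subset_refl] by simp
qed

lemma open_natural_chart_image:
  assumes "smooth_manifold M" "c \<in> atlas M"
  shows "open (snd (natural_chart M c) ` fst (natural_chart M c))"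
  using chart_image_open[OF assms] by (simp add: natural_chart_image_eq[OF assms] open_Times)

lemma lagrangian_smooth_in_natural_chart:
  assumes "lagrangian M L" "c \<in> atlas M"
  shows "smooth_on (L \<circ> chart_inv (natural_chart M c)) (snd (natural_chart M c) ` fst (natural_chart M c))"
proof -
  have "natural_chart M c \<in> atlas (tangent_bundle M)"
    using assms(2) by (simp add: tangent_bundle_def)
  then have "smooth_on (snd (UNIV, id) \<circ> L \<circ> chart_inv (natural_chart M c))
      (snd (natural_chart M c) ` {Y \<in> fst (natural_chart M c). L Y \<in> fst (UNIV, id)})"
    using assms(1) unfolding lagrangian_def smooth_map_def open_mfd_def by auto
  then show ?thesis
    by simp
qed

lemma vel_hessian_eq:
  assumes M: "smooth_manifold M" "c \<in> atlas M" and Y: "Y \<in> fst (natural_chart M c)"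
  shows "vel_hessian M c f Y $ i $ j
    = fderiv2 (f \<circ> chart_inv (natural_chart M c)) (snd (natural_chart M c) Y) (0, axis i 1) (0, axis j 1)"
  using chart_partial_twice[OF inj_on_natural_chart[OF M] open_natural_chart_image[OF M] Y]
  by (simp add: vel_hessian_def vel_partial_def)

text \<open>
  The velocity component of the Euler--Lagrangian vector field is the acceleration at which the Euler--Lagrange
  residual vanishes; it is found by inverting the velocity Hessian, the coefficient of the acceleration.
\<close>

lemma EL_vector_field_coords:
  assumes M: "smooth_manifold M" "c \<in> atlas M" and L: "lagrangian M L" and reg: "regular_lagrangian M c L"
    and Y: "Y \<in> fst (natural_chart M c)"
  obtains A where "EL_vector_field M c L Y = tvec_of_coords (tangent_bundle M) (natural_chart M c) Y (snd Y c, A)"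
    and "\<And>a. EL_residual (L \<circ> chart_inv (natural_chart M c)) (snd (natural_chart M c) Y) A a = 0"
proof
  let ?\<Lambda> = "L \<circ> chart_inv (natural_chart M c)"
  let ?W = "snd (natural_chart M c) ` fst (natural_chart M c)"
  let ?z = "snd (natural_chart M c) Y"
  let ?v = "snd Y c"
  let ?H = "vel_hessian M c L Y"
  let ?r = "\<chi> j. pos_partial M c j L Y - (\<Sum>k\<in>UNIV. pos_partial M c k (vel_partial M c j L) Y * ?v $ k)"
  define A where "A = matrix_inv ?H *v ?r"
  show "EL_vector_field M c L Y
      = tvec_of_coords (tangent_bundle M) (natural_chart M c) Y (snd Y c, A)"
    by (simp add: EL_vector_field_def Let_def A_def)
  note \<Lambda> = lagrangian_smooth_in_natural_chart[OF L M(2)]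
  have W: "open ?W" "?z \<in> ?W"
    using open_natural_chart_image[OF M] Y by auto
  have v: "snd ?z = ?v"
    by (simp add: natural_chart_def split: prod.split)
  have mixed: "pos_partial M c k (vel_partial M c j L) Y = fderiv2 ?\<Lambda> ?z (axis k 1, 0) (0, axis j 1)" for k j
    using chart_partial_twice[OF inj_on_natural_chart[OF M] open_natural_chart_image[OF M] Y]
    by (simp add: pos_partial_def vel_partial_def)
  have lin: "linear (\<lambda>a. fderiv2 ?\<Lambda> ?z (a, 0) b)" for b
    using linear_compose[OF linear_Pair_left linear_fderiv2_left[OF \<Lambda> W(2)]] by (simp add: o_def)
  have r: "?r $ j = fderiv ?\<Lambda> ?z (axis j 1, 0) - fderiv2 ?\<Lambda> ?z (?v, 0) (0, axis j 1)" for j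
    using linear_axis_sum[OF lin[of "(0, axis j 1)"], of ?v]
    by (simp add: mixed mult.commute) (simp add: pos_partial_def chart_partial_def)
  define h where "h a b = fderiv2 ?\<Lambda> ?z (0, a) (0, b)" for a b
  have "linear (h a)" for a
    unfolding h_def using linear_compose[OF linear_Pair_right linear_fderiv2_right[OF \<Lambda> W]]
    by (simp add: o_def)
  from bilinear_matrix_vector[of h ?H A, OF this] have HA: "(?H *v A) $ i = h (axis i 1) A" for i
    using vel_hessian_eq[OF M Y] unfolding h_def by blast
  have "?H *v A = ?r"
    unfolding A_def using reg Y by (intro matrix_inv_vector_mult) (auto simp: regular_lagrangian_def)
  then have "fderiv2 ?\<Lambda> ?z (0, A) (0, axis j 1)
      = fderiv ?\<Lambda> ?z (axis j 1, 0) - fderiv2 ?\<Lambda> ?z (?v, 0) (0, axis j 1)" for j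
    using HA[of j] r[of j] fderiv2_commute[OF \<Lambda> W, of "(0, axis j 1)" "(0, A)"] unfolding h_def by simp
  then have axis: "EL_residual ?\<Lambda> ?z A (axis j 1) = 0" for j
    using linear_add[OF linear_fderiv2_left[OF \<Lambda> W(2), where b = "(0, axis j 1)"], of "(?v, 0)" "(0, A)"]
    by (simp add: EL_residual_def v)
  show "EL_residual ?\<Lambda> ?z A a = 0" for a
    by (subst linear_axis_sum[OF linear_EL_residual[OF \<Lambda> W]]) (simp add: axis)
qed

section \<open>Reduction of a Lagrangian system\<close>

text \<open>The data that do not involve the initial value problem.\<close>

locale lagrangian_reduction =
  fixes Q :: "('a, real^'n) mfd" and Q' :: "('b, real^'m) mfd"
    and c :: "('a, real^'n) chart" and c' :: "('b, real^'m) chart"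
    and L :: "'a \<times> ('a, real^'n) tvec \<Rightarrow> real"
    and \<tau>q :: "'a \<times> ('a, real^'n) tvec \<Rightarrow> real^'n^'n"
    and \<phi>Q :: "'b \<Rightarrow> 'a" and \<rho>Q :: "'a \<Rightarrow> 'b"
  assumes Q: "smooth_manifold Q" and Q': "smooth_manifold Q'"
    and c: "c \<in> atlas Q" and c': "c' \<in> atlas Q'" and \<phi>_charts: "\<phi>Q ` fst c' \<subseteq> fst c"
    and L: "lagrangian Q L" and regular: "regular_lagrangian Q c L"
    and \<phi>: "smooth_map Q' Q \<phi>Q" and \<rho>: "point_reduction Q' Q \<phi>Q \<rho>Q"
    and regular_reduced: "regular_lagrangian Q' c' (L \<circ> tangent_map Q' Q \<phi>Q)"
    and nondegenerate_reduced: "nondegenerate_on (tangent_bundle Q') (fst (natural_chart Q' c'))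
           (pullback_tensor (tangent_bundle Q') (tangent_bundle Q) (tangent_map Q' Q \<phi>Q)
              (tau_LMG Q c L \<tau>q))"
begin

abbreviation "\<xi> \<equiv> natural_chart Q c"
abbreviation "\<xi>' \<equiv> natural_chart Q' c'"
abbreviation "T\<phi> \<equiv> tangent_map Q' Q \<phi>Q"

definition "F = snd c \<circ> \<phi>Q \<circ> chart_inv c'"
definition "\<Lambda> = L \<circ> chart_inv \<xi>"
definition "U = snd c' ` fst c'"
definition "W = snd \<xi> ` fst \<xi>"

sublocale Q: differentiable_atlas Q
  by (rule smooth_manifold_differentiable_atlas[OF Q])

sublocale Q': differentiable_atlas Q'
  by (rule smooth_manifold_differentiable_atlas[OF Q'])

sublocale TQ: differentiable_atlas "tangent_bundle Q"
  by (rule tangent_bundle_differentiable_atlas[OF Q])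

sublocale TQ': differentiable_atlas "tangent_bundle Q'"
  by (rule tangent_bundle_differentiable_atlas[OF Q'])

lemma U_eq: "U = snd c' ` {p \<in> fst c'. \<phi>Q p \<in> fst c}"
  using \<phi>_charts by (auto simp: U_def)

lemma open_U: "open U"
  unfolding U_def by (rule chart_image_open[OF Q' c'])

lemma smooth_F: "smooth_on F U"
  unfolding F_def U_eq by (rule smooth_map_in_charts[OF Q' Q \<phi> c' c])

lemma smooth_\<Lambda>: "smooth_on \<Lambda> W"
  unfolding \<Lambda>_def W_def by (rule lagrangian_smooth_in_natural_chart[OF L c])

lemma open_W: "open W"
  unfolding W_def by (rule open_natural_chart_image[OF Q c])

lemma tangent_map_mem:
  assumes "Y \<in> fst \<xi>'"
  shows "T\<phi> Y \<in> fst \<xi>"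
proof -
  obtain q v where Y: "Y = (q, v)"
    by fastforce
  show ?thesis
    unfolding Y by (rule tangent_map_mem_natural_chart[OF Q' Q \<phi>, of c'])
      (use assms Y c' \<phi>_charts in \<open>auto simp: charts_at_def\<close>)
qed

lemma tangent_map_coords:
  assumes "Y \<in> fst \<xi>'"
  shows "snd \<xi> (T\<phi> Y) = tangent_fun F (snd \<xi>' Y)"
proof -
  obtain q v where Y: "Y = (q, v)"
    by fastforce
  show ?thesis
    unfolding Y natural_chart_apply[of Q'] F_def
    by (rule tangent_map_in_natural_charts[OF Q' Q \<phi>])
      (use assms Y c c' \<phi>_charts in \<open>auto simp: charts_at_def\<close>)
qed

lemma natural_coords_mem:
  assumes "Y \<in> fst \<xi>'"
  shows "fst (snd \<xi>' Y) \<in> U" "tangent_fun F (snd \<xi>' Y) \<in> W"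
  using assms tangent_map_mem[OF assms] unfolding tangent_map_coords[OF assms, symmetric]
  by (auto simp: U_def W_def natural_chart_def)

lemma reduced_lagrangian_coords:
  assumes "fst z \<in> U"
  shows "((L \<circ> T\<phi>) \<circ> chart_inv \<xi>') z = (\<Lambda> \<circ> tangent_fun F) z"
proof -
  have "z \<in> snd \<xi>' ` fst \<xi>'"
    using assms by (cases z) (auto simp: natural_chart_image_eq[OF Q' c'] U_def)
  then obtain Y where Y: "Y \<in> fst \<xi>'" "z = snd \<xi>' Y"
    by blast
  show ?thesis
    using chart_inv_eq[OF inj_on_natural_chart[OF Q c] tangent_map_mem[OF Y(1)]]
      chart_inv_eq[OF inj_on_natural_chart[OF Q' c'] Y(1)]
    by (simp add: \<Lambda>_def Y(2) flip: tangent_map_coords[OF Y(1)])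
qed

lemma eventually_reduced_lagrangian_coords:
  assumes "fst z \<in> U"
  shows "\<forall>\<^sub>F z in nhds z. ((L \<circ> T\<phi>) \<circ> chart_inv \<xi>') z = (\<Lambda> \<circ> tangent_fun F) z"
    and "\<forall>\<^sub>F z in nhds z. fderiv ((L \<circ> T\<phi>) \<circ> chart_inv \<xi>') z b = fderiv (\<Lambda> \<circ> tangent_fun F) z b"
proof -
  have near: "\<forall>\<^sub>F z in nhds z. z \<in> U \<times> UNIV" if "fst z \<in> U" for z :: "(real^'m) \<times> (real^'m)"
    using open_U that by (intro eventually_nhds_in_open) (auto simp: open_Times mem_Times_iff)
  have 1: "\<forall>\<^sub>F z in nhds z. ((L \<circ> T\<phi>) \<circ> chart_inv \<xi>') z = (\<Lambda> \<circ> tangent_fun F) z" if "fst z \<in> U" for z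
    using near[OF that] by (rule eventually_mono) (rule reduced_lagrangian_coords, auto)
  show "\<forall>\<^sub>F z in nhds z. ((L \<circ> T\<phi>) \<circ> chart_inv \<xi>') z = (\<Lambda> \<circ> tangent_fun F) z"
    by (rule 1[OF assms])
  show "\<forall>\<^sub>F z in nhds z. fderiv ((L \<circ> T\<phi>) \<circ> chart_inv \<xi>') z b = fderiv (\<Lambda> \<circ> tangent_fun F) z b"
    using near[OF assms] by (rule eventually_mono) (rule fun_cong[OF fderiv_cong_eventually[OF 1]], auto)
qed

lemma lagrangian_pullback_at_state:
  assumes "Y \<in> fst \<xi>'"
  shows "lagrangian_pullback F \<Lambda> U W (fst (snd \<xi>' Y)) (snd (snd \<xi>' Y))"
  using smooth_F open_U smooth_\<Lambda> open_W natural_coords_mem[OF assms] by unfold_locales auto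

text \<open>
  The velocity of the lift at time \<open>t\<close> has coordinates \<open>(v, s)\<close>, where \<open>v\<close> is the velocity coordinate of the lift
  itself. By the chain rule the time derivative of the momentum is therefore the second derivative
  of the Lagrangian in the direction \<open>(v, s)\<close>, as in \<open>EL_residual\<close>.
\<close>

lemma euler_lagrange_iff_residual:
  assumes S: "open S" and \<gamma>: "smooth_map (open_mfd S) Q' \<gamma>" and t: "t \<in> S" and in_chart: "\<gamma> t \<in> fst c'"
  defines "Y \<equiv> curve_lift Q' \<gamma>"
  shows "(\<forall>i. pos_partial Q' c' i (L \<circ> T\<phi>) (Y t) - deriv (\<lambda>s. vel_partial Q' c' i (L \<circ> T\<phi>) (Y s)) t = 0)
    \<longleftrightarrow> (\<forall>a. EL_residual (\<Lambda> \<circ> tangent_fun F) (snd \<xi>' (Y t))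
          (snd (velocity (tangent_bundle Q') Y t \<xi>')) a = 0)"
proof -
  let ?\<Lambda>' = "(L \<circ> T\<phi>) \<circ> chart_inv \<xi>'"
  define V where "V = velocity (tangent_bundle Q') Y t \<xi>'"
  define z where "z = snd \<xi>' (Y t)"
  have Yt: "Y t \<in> fst \<xi>'"
    unfolding Y_def using curve_lift_mem_natural_chart[OF Q' S \<gamma> t] in_chart by blast
  interpret lagrangian_pullback F \<Lambda> U W "fst z" "snd z"
    unfolding z_def by (rule lagrangian_pullback_at_state[OF Yt])
  have V: "(snd \<xi>' \<circ> Y has_vector_derivative V) (at t)" and "fst V = velocity Q' \<gamma> t c'"
    unfolding V_def Y_def
    using velocity_in_natural_chart[OF S smooth_map_curve_lift[OF Q' S \<gamma>] t c' Yt[unfolded Y_def]]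
    by (simp_all add: base_of_curve_lift)
  then have V_eq: "V = (snd z, snd V)"
    by (simp add: z_def Y_def curve_lift_def prod_eq_iff)
  note ev = eventually_reduced_lagrangian_coords[OF U(2)]
  have residual: "pos_partial Q' c' i (L \<circ> T\<phi>) (Y t) - deriv (\<lambda>s. vel_partial Q' c' i (L \<circ> T\<phi>) (Y s)) t
      = EL_residual (\<Lambda> \<circ> tangent_fun F) z (snd V) (axis i 1)" for i
  proof -
    let ?e = "axis i 1 :: real^'m"
    have "((\<lambda>y. fderiv (\<Lambda> \<circ> tangent_fun F) y (0, ?e)) has_derivative
        (\<lambda>h. fderiv2 (\<Lambda> \<circ> tangent_fun F) z h (0, ?e))) (at z)"
      using has_derivative_velocity_derivative_pullback[of ?e]
      by (intro has_derivative_fderiv) (auto simp: differentiable_def)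
    then have "((\<lambda>y. fderiv ?\<Lambda>' y (0, ?e)) has_derivative
        (\<lambda>h. fderiv2 (\<Lambda> \<circ> tangent_fun F) z h (0, ?e))) (at z)"
      by (rule has_derivative_cong_eventually)
        (use ev(2)[of "(0, ?e)"] in \<open>auto elim: eventually_mono\<close>)
    then have D: "((\<lambda>y. fderiv ?\<Lambda>' y (0, ?e)) has_derivative
        (\<lambda>h. fderiv2 (\<Lambda> \<circ> tangent_fun F) z h (0, ?e))) (at ((snd \<xi>' \<circ> Y) t))"
      by (simp add: z_def)
    have lin: "linear (\<lambda>h. fderiv2 (\<Lambda> \<circ> tangent_fun F) z h (0, ?e))"
      by (rule has_derivative_linear[OF D])
    have "((\<lambda>s. fderiv ?\<Lambda>' ((snd \<xi>' \<circ> Y) s) (0, ?e)) has_derivative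
        (\<lambda>r. fderiv2 (\<Lambda> \<circ> tangent_fun F) z (r *\<^sub>R V) (0, ?e))) (at t)"
      using has_derivative_compose[OF V[unfolded has_vector_derivative_def] D] .
    then have "((\<lambda>s. vel_partial Q' c' i (L \<circ> T\<phi>) (Y s)) has_real_derivative
        fderiv2 (\<Lambda> \<circ> tangent_fun F) z V (0, ?e)) (at t)"
      by (simp add: has_field_derivative_def vel_partial_def chart_partial_def linear_cmul[OF lin]
          mult_commute_abs)
    then have "deriv (\<lambda>s. vel_partial Q' c' i (L \<circ> T\<phi>) (Y s)) t
        = fderiv2 (\<Lambda> \<circ> tangent_fun F) z (snd z, snd V) (0, ?e)"
      using DERIV_imp_deriv V_eq by metis
    moreover have "pos_partial Q' c' i (L \<circ> T\<phi>) (Y t) = fderiv (\<Lambda> \<circ> tangent_fun F) z (?e, 0)"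
      unfolding pos_partial_def chart_partial_def z_def[symmetric]
      by (rule fun_cong[OF fderiv_cong_eventually[OF ev(1)]])
    ultimately show ?thesis
      by (simp add: EL_residual_def)
  qed
  have lin: "linear (EL_residual (\<Lambda> \<circ> tangent_fun F) z (snd V))"
    using linear_EL_residual_pullback[of "snd V"] by (simp only: prod.collapse)
  have "EL_residual (\<Lambda> \<circ> tangent_fun F) z (snd V) a = 0"
    if "\<forall>i. EL_residual (\<Lambda> \<circ> tangent_fun F) z (snd V) (axis i 1) = 0" for a
    by (subst linear_axis_sum[OF lin]) (simp add: that)
  then have "(\<forall>i. EL_residual (\<Lambda> \<circ> tangent_fun F) z (snd V) (axis i 1) = 0)
      \<longleftrightarrow> (\<forall>a. EL_residual (\<Lambda> \<circ> tangent_fun F) z (snd V) a = 0)"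
    by blast
  then show ?thesis
    unfolding residual z_def[symmetric] V_def[symmetric] .
qed

lemma lifted_point_reduction:
  assumes "Y \<in> fst \<xi>'"
  shows "tangent_map Q Q' \<rho>Q (T\<phi> Y) = Y"
proof -
  obtain q v where Y: "Y = (q, v)"
    by fastforce
  have qv: "q \<in> fst c'" "v \<in> tangent_space Q' q"
    using assms by (auto simp: Y)
  have charts: "c' \<in> charts_at Q' q" "c \<in> charts_at Q (\<phi>Q q)"
    using qv c c' \<phi>_charts by (auto simp: charts_at_def)
  have \<rho>\<phi>: "\<rho>Q (\<phi>Q p) = p" if "p \<in> fst c'" for p
    using \<rho> openin_subset[OF chart_openin[OF Q' c']] that unfolding point_reduction_def by blast
  have "smooth_map Q Q' \<rho>Q"
    using \<rho> unfolding point_reduction_def by blast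
  then have "differential Q Q' \<rho>Q (\<phi>Q q) (differential Q' Q \<phi>Q q v) = v"
    using differential_left_inverse[OF Q'.differentiable_atlas_axioms Q.differentiable_atlas_axioms
        smooth_map_differentiable_in_charts[OF Q' Q \<phi>] smooth_map_differentiable_in_charts[OF Q Q']
        \<rho>\<phi> charts qv(2)] by blast
  then show ?thesis
    using \<rho>\<phi>[OF qv(1)] by (simp add: Y tangent_map_def)
qed

lemma tau_LMG_coords:
  fixes m
  assumes m: "m \<in> fst \<xi>"
  shows "tau_LMG Q c L \<tau>q m u w =
    (\<Sum>i\<in>UNIV. \<Sum>j\<in>UNIV. \<tau>q m $ i $ j * snd (u \<xi>) $ i * fst (w \<xi>) $ j)
      + fderiv2 \<Lambda> (snd \<xi> m) (0, fst (u \<xi>)) (0, snd (w \<xi>))"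
proof -
  have z: "snd \<xi> m \<in> W"
    using m by (auto simp: W_def)
  have "linear (\<lambda>a. fderiv2 \<Lambda> (snd \<xi> m) (0, a) (0, b))" "linear (\<lambda>b. fderiv2 \<Lambda> (snd \<xi> m) (0, a) (0, b))" for a b
    using linear_compose[OF linear_Pair_right linear_fderiv2_left[OF smooth_\<Lambda> z]]
      linear_compose[OF linear_Pair_right linear_fderiv2_right[OF smooth_\<Lambda> open_W z]]
    by (simp_all add: o_def)
  from bilinear_axis_sum[of "\<lambda>a b. fderiv2 \<Lambda> (snd \<xi> m) (0, a) (0, b)", OF this]
  show ?thesis
    unfolding tau_LMG_def Let_def vel_hessian_eq[OF Q c m] \<Lambda>_def[symmetric] by simp
qed

text \<open>
  Reading \<open>\<sharp>\<close> as a weak equation and evaluating the tensor in natural charts leads to the situation of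
  \<open>Galerkin_equation_iff\<close>. Since \<open>w\<close> is arbitrary, both directions of the equivalence of the
  reduced-order model with the reduced Euler--Lagrange equations follow from this single statement.
\<close>

lemma LMG_ROM_iff_residual:
  assumes Y: "Y \<in> fst \<xi>'" and w: "w \<in> tangent_space (tangent_bundle Q') Y"
  shows "w = R_LMG Q' Q c \<phi>Q \<rho>Q L \<tau>q (T\<phi> Y) (EL_vector_field Q c L (T\<phi> Y)) \<longleftrightarrow>
    fst (w \<xi>') = snd Y c' \<and>
    (\<forall>a. EL_residual (\<Lambda> \<circ> tangent_fun F) (snd \<xi>' Y) (snd (w \<xi>')) a = 0)"
proof -
  define m where "m = T\<phi> Y"
  define x where "x = fst (snd \<xi>' Y)"
  define v where "v = snd (snd \<xi>' Y)"
  have xv: "snd \<xi>' Y = (x, v)" and v: "v = snd Y c'"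
    by (auto simp: x_def v_def natural_chart_def split: prod.split)
  interpret lagrangian_pullback F \<Lambda> U W x v
    unfolding x_def v_def by (rule lagrangian_pullback_at_state[OF Y])
  have m: "m \<in> fst \<xi>"
    unfolding m_def by (rule tangent_map_mem[OF Y])
  have z: "snd \<xi> m = tangent_fun F (x, v)"
    unfolding m_def tangent_map_coords[OF Y] xv ..
  have \<xi>: "\<xi> \<in> charts_at (tangent_bundle Q) m" and \<xi>': "\<xi>' \<in> charts_at (tangent_bundle Q') Y"
    using c c' m Y by (auto simp: charts_at_def tangent_bundle_def)
  note T\<phi>_diff = tangent_map_differentiable_in_charts[OF Q' Q \<phi>]
  let ?d = "differential (tangent_bundle Q') (tangent_bundle Q) T\<phi> Y"
  let ?T = "tangent_space (tangent_bundle Q') Y"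
  have d_coords: "?d u \<xi> = d\<phi> (u \<xi>')" if u: "u \<in> ?T" for u
  proof -
    obtain q v0 where Yq: "Y = (q, v0)"
      by fastforce
    have charts: "c' \<in> charts_at Q' q" "c \<in> charts_at Q (\<phi>Q q)"
      using Y c c' \<phi>_charts by (auto simp: Yq charts_at_def)
    have xq: "x = snd c' q"
      by (simp add: x_def Yq)
    have "fderiv (snd \<xi> \<circ> T\<phi> \<circ> chart_inv \<xi>') (x, v) = d\<phi>"
      using fderiv_eqI[OF tangent_map_chart_has_derivative(1)[OF Q' Q \<phi> charts, of v]]
      unfolding xq[symmetric] F_def[symmetric] d\<phi>_def[abs_def] .
    then show ?thesis
      using differential_component[OF TQ'.differentiable_atlas_axioms T\<phi>_diff u \<xi>' \<xi>[unfolded m_def]]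
      by (simp add: xv)
  qed
  have d_tangent: "?d u \<in> tangent_space (tangent_bundle Q) m" if "u \<in> ?T" for u
    unfolding m_def
    by (rule differential_in_tangent_space[OF TQ'.differentiable_atlas_axioms TQ.differentiable_atlas_axioms
          T\<phi>_diff \<xi>' that])
  define k where "k a b = (\<Sum>i\<in>UNIV. \<Sum>j\<in>UNIV. \<tau>q m $ i $ j * a $ i * b $ j)" for a b
  have k: "linear (\<lambda>a. k a b)" "linear (\<lambda>b. k a b)" for a b
    unfolding k_def by (auto intro!: linearI simp: algebra_simps sum.distrib sum_distrib_left)
  define \<tau> where "\<tau> u w = k (snd u) (fst w) + fderiv2 \<Lambda> (tangent_fun F (x, v)) (0, fst u) (0, snd w)" for u w
  have \<tau>: "tau_LMG Q c L \<tau>q m u w = \<tau> (u \<xi>) (w \<xi>)" for u w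
    unfolding tau_LMG_coords[OF m] \<tau>_def k_def z ..
  have lin_\<tau>: "linear (\<lambda>u. \<tau> u w)" "linear (\<lambda>w. \<tau> u w)" for u w
  proof -
    have "linear (\<lambda>u. k (snd u) (fst w))" "linear (\<lambda>w. k (snd u) (fst w))"
      using linear_compose[OF linear_snd k(1)] linear_compose[OF linear_fst k(2)] by (simp_all add: o_def)
    moreover have "linear (\<lambda>u. fderiv2 \<Lambda> (tangent_fun F (x, v)) (0, fst u) (0, snd w))"
      "linear (\<lambda>w. fderiv2 \<Lambda> (tangent_fun F (x, v)) (0, fst u) (0, snd w))"
      using linear_compose[OF linear_compose[OF linear_fst linear_Pair_right] linear_fderiv2_left[OF \<Lambda> W(2)]]
        linear_compose[OF linear_compose[OF linear_snd linear_Pair_right] linear_fderiv2_right[OF \<Lambda> W]]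
      by (simp_all add: o_def)
    ultimately show "linear (\<lambda>u. \<tau> u w)" "linear (\<lambda>w. \<tau> u w)"
      unfolding \<tau>_def by (auto intro: linear_compose_add)
  qed
  have lin_d\<phi>: "linear d\<phi>"
    by (rule has_derivative_linear[OF has_derivative_tangent_fun_F])
  define X where "X = EL_vector_field Q c L m"
  obtain A where X_eq: "X = tvec_of_coords (tangent_bundle Q) \<xi> m (snd m c, A)"
    and A: "\<And>a. EL_residual \<Lambda> (tangent_fun F (x, v)) A a = 0"
    using EL_vector_field_coords[OF Q c L regular m] unfolding X_def \<Lambda>_def[symmetric] z by blast
  have "snd m c = fderiv F x v"
    using arg_cong[OF z, of snd] by (simp add: natural_chart_def tangent_fun_def split: prod.splits)
  then have X: "X \<xi> = (fderiv F x v, A)"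
    unfolding X_eq by (simp add: TQ.tvec_of_coords_component[OF \<xi>])
  let ?\<tau>' = "pullback_tensor (tangent_bundle Q') (tangent_bundle Q) T\<phi> (tau_LMG Q c L \<tau>q)"
  have \<tau>': "?\<tau>' Y u w = \<tau> (d\<phi> (u \<xi>')) (d\<phi> (w \<xi>'))" if "u \<in> ?T" "w \<in> ?T" for u w
    unfolding pullback_tensor_def m_def[symmetric] \<tau> d_coords[OF that(1)] d_coords[OF that(2)] ..
  have nondeg: "u = (\<lambda>_. 0)" if "u \<in> ?T" "\<forall>w\<in>?T. ?\<tau>' Y w u = 0" for u
    using nondegenerate_reduced Y that unfolding nondegenerate_on_def by blast
  have nondeg_coords: "b = 0" if b: "\<And>u. \<tau> (d\<phi> u) (d\<phi> b) = 0" for b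
  proof -
    note vec = TQ'.tvec_of_coords_in_tangent_space[OF \<xi>']
    have "tvec_of_coords (tangent_bundle Q') \<xi>' Y b = (\<lambda>_. 0)"
      using vec b by (intro nondeg) (auto simp: \<tau>' TQ'.tvec_of_coords_component[OF \<xi>'])
    then show ?thesis
      using TQ'.tvec_of_coords_component[OF \<xi>', of b] by simp
  qed
  have regular_coords: "b = 0" if "\<And>a. fderiv2 (\<Lambda> \<circ> tangent_fun F) (x, v) (0, a) (0, b) = 0" for b
  proof (rule invertible_imp_nondegenerate)
    show "invertible (vel_hessian Q' c' (L \<circ> T\<phi>) Y)"
      using regular_reduced Y unfolding regular_lagrangian_def by blast
    show "linear (\<lambda>b. fderiv2 (\<Lambda> \<circ> tangent_fun F) (x, v) (0, a) (0, b))" for a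
      unfolding velocity_hessian_pullback
      using linear_compose[OF linear_compose[OF linear_F linear_Pair_right] linear_fderiv2_right[OF \<Lambda> W]]
      by (simp add: o_def)
    have "fst (x, v) \<in> U"
      using U by simp
    note ev = eventually_reduced_lagrangian_coords(2)[OF this]
    show "vel_hessian Q' c' (L \<circ> T\<phi>) Y $ i $ j
        = fderiv2 (\<Lambda> \<circ> tangent_fun F) (x, v) (0, axis i 1) (0, axis j 1)" for i j
      unfolding vel_hessian_eq[OF Q' c' Y] xv by (rule fun_cong[OF fderiv_cong_eventually[OF ev]])
  qed (rule that)
  have "R_LMG Q' Q c \<phi>Q \<rho>Q L \<tau>q m X
      = sharp (tangent_bundle Q') ?\<tau>' Y (restrict (\<lambda>u. tau_LMG Q c L \<tau>q m (?d u) X) ?T)"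
  proof -
    have "tangent_map Q Q' \<rho>Q m = Y"
      unfolding m_def by (rule lifted_point_reduction[OF Y])
    moreover have "pullback_covector (tangent_bundle Q') (tangent_bundle Q) T\<phi> Y
        (flat (tangent_bundle Q) (tau_LMG Q c L \<tau>q) m X)
        = restrict (\<lambda>u. tau_LMG Q c L \<tau>q m (?d u) X) ?T"
      unfolding pullback_covector_def flat_def by (rule restrict_ext) (simp add: d_tangent)
    ultimately show ?thesis
      by (simp add: R_LMG_def reduction_map_at_def)
  qed
  moreover have "w = sharp (tangent_bundle Q') ?\<tau>' Y (restrict (\<lambda>u. tau_LMG Q c L \<tau>q m (?d u) X) ?T)
      \<longleftrightarrow> (\<forall>u. \<tau> (d\<phi> u) (d\<phi> (w \<xi>')) = \<tau> (d\<phi> u) (X \<xi>))"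
  proof (rule sharp_eq_iff[OF TQ'.differentiable_atlas_axioms \<xi>', where B = "\<lambda>u w. \<tau> (d\<phi> u) (d\<phi> w)"])
    show "linear (\<lambda>u. \<tau> (d\<phi> u) (d\<phi> w))" "linear (\<lambda>w. \<tau> (d\<phi> u) (d\<phi> w))" "linear (\<lambda>u. \<tau> (d\<phi> u) (X \<xi>))" for u w
      using linear_compose[OF lin_d\<phi> lin_\<tau>(1)] linear_compose[OF lin_d\<phi> lin_\<tau>(2)]
      by (simp_all add: o_def)
    show "tau_LMG Q c L \<tau>q m (?d u) X = \<tau> (d\<phi> (u \<xi>')) (X \<xi>)" if "u \<in> ?T" for u
      unfolding \<tau> d_coords[OF that] ..
  qed (use \<tau>' nondeg w in auto)
  moreover have "(\<forall>u. \<tau> (d\<phi> u) (d\<phi> (fst (w \<xi>'), snd (w \<xi>'))) = \<tau> (d\<phi> u) (fderiv F x v, A)) \<longleftrightarrow>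
      fst (w \<xi>') = v \<and> (\<forall>a. EL_residual (\<Lambda> \<circ> tangent_fun F) (x, v) (snd (w \<xi>')) a = 0)"
    unfolding \<tau>_def
    by (rule Galerkin_equation_iff[OF k]) (use nondeg_coords regular_coords A in \<open>auto simp: \<tau>_def\<close>)
  ultimately show ?thesis
    unfolding m_def[symmetric] X_def[symmetric] xv v[symmetric] by (simp add: X)
qed

end

theorem theorem5p7:
  fixes Q :: "('a, real^'n) mfd" and Q' :: "('b, real^'m) mfd"
    and c :: "('a, real^'n) chart" and c' :: "('b, real^'m) chart"
    and L :: "'a \<times> ('a, real^'n) tvec \<Rightarrow> real"
    and \<tau>q :: "'a \<times> ('a, real^'n) tvec \<Rightarrow> real^'n^'n"
    and \<phi>Q :: "'b \<Rightarrow> 'a" and \<rho>Q :: "'a \<Rightarrow> 'b"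
    and t0 tf :: real
    and q0 :: 'a and v0 :: "('a, real^'n) tvec"
  assumes "t0 < tf"
    and "smooth_manifold Q" and "smooth_manifold Q'"
    and "c \<in> atlas Q" and "c' \<in> atlas Q'" and "\<phi>Q ` fst c' \<subseteq> fst c"
    and "lagrangian Q L" and "regular_lagrangian Q c L"
    and "(q0, v0) \<in> topspace (mtop (tangent_bundle Q))"
    and "smooth_embedding Q' Q \<phi>Q" and "point_reduction Q' Q \<phi>Q \<rho>Q"
    and "regular_lagrangian Q' c' (L \<circ> tangent_map Q' Q \<phi>Q)"
    and "\<And>i j. smooth_on (\<lambda>z. \<tau>q (chart_inv (natural_chart Q c) z) $ i $ j)
                 (snd (natural_chart Q c) ` fst (natural_chart Q c))"
    and "nondegenerate_on (tangent_bundle Q) (fst (natural_chart Q c)) (tau_LMG Q c L \<tau>q)"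
    and "nondegenerate_on (tangent_bundle Q') (fst (natural_chart Q' c'))
           (pullback_tensor (tangent_bundle Q') (tangent_bundle Q) (tangent_map Q' Q \<phi>Q)
              (tau_LMG Q c L \<tau>q))"
  shows "(\<forall>\<gamma>Q. solves_euler_lagrange Q' c' (L \<circ> tangent_map Q' Q \<phi>Q) t0 tf
                 (tangent_map Q Q' \<rho>Q (q0, v0)) \<gamma>Q \<longrightarrow>
               solves_LMG_ROM Q' c' Q c \<phi>Q \<rho>Q L \<tau>q t0 tf (q0, v0) (curve_lift Q' \<gamma>Q)) \<and>
         (\<forall>\<gamma>. solves_LMG_ROM Q' c' Q c \<phi>Q \<rho>Q L \<tau>q t0 tf (q0, v0) \<gamma> \<longrightarrow>
            (\<exists>\<gamma>Q. solves_euler_lagrange Q' c' (L \<circ> tangent_map Q' Q \<phi>Q) t0 tf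
                    (tangent_map Q Q' \<rho>Q (q0, v0)) \<gamma>Q \<and>
                 (\<forall>t\<in>{t0<..<tf}. \<gamma> t = curve_lift Q' \<gamma>Q t)))"
proof -
  interpret lagrangian_reduction Q Q' c c' L \<tau>q \<phi>Q \<rho>Q
    using assms by unfold_locales (auto simp: smooth_embedding_def)
  define S where "S = {t0<..<tf}"
  have S: "open S"
    by (simp add: S_def)
  let ?Y0 = "tangent_map Q Q' \<rho>Q (q0, v0)"
  let ?X = "\<lambda>Y. R_LMG Q' Q c \<phi>Q \<rho>Q L \<tau>q (T\<phi> Y) (EL_vector_field Q c L (T\<phi> Y))"
  have ROM: "solves_LMG_ROM Q' c' Q c \<phi>Q \<rho>Q L \<tau>q t0 tf (q0, v0) \<Gamma> \<longleftrightarrow>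
      smooth_map (open_mfd S) (tangent_bundle Q') \<Gamma> \<and> (\<forall>t\<in>S. \<Gamma> t \<in> fst \<xi>') \<and>
      (\<forall>t\<in>S. velocity (tangent_bundle Q') \<Gamma> t = ?X (\<Gamma> t)) \<and>
      limitin (mtop (tangent_bundle Q')) \<Gamma> ?Y0 (at_right t0)" for \<Gamma>
    unfolding solves_LMG_ROM_def solves_ivp_def Let_def S_def by blast
  have EL: "solves_euler_lagrange Q' c' (L \<circ> T\<phi>) t0 tf ?Y0 \<gamma> \<longleftrightarrow>
      smooth_map (open_mfd S) Q' \<gamma> \<and> (\<forall>t\<in>S. \<gamma> t \<in> fst c') \<and>
      (\<forall>t\<in>S. \<forall>a. EL_residual (\<Lambda> \<circ> tangent_fun F) (snd \<xi>' (curve_lift Q' \<gamma> t))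
          (snd (velocity (tangent_bundle Q') (curve_lift Q' \<gamma>) t \<xi>')) a = 0) \<and>
      limitin (mtop (tangent_bundle Q')) (curve_lift Q' \<gamma>) ?Y0 (at_right t0)" for \<gamma>
    unfolding solves_euler_lagrange_def S_def[symmetric] image_subset_iff
    using euler_lagrange_iff_residual[OF S] by blast
  have velocity_tangent: "velocity (tangent_bundle Q') \<Gamma> t \<in> tangent_space (tangent_bundle Q') (\<Gamma> t)"
    if "smooth_map (open_mfd S) (tangent_bundle Q') \<Gamma>" "t \<in> S" for \<Gamma> t
    by (rule velocity_in_tangent_space[OF TQ'.differentiable_atlas_axioms
          smooth_curve_differentiable[OF S natural_charts_openin that]])
  show ?thesis
  proof (intro conjI allI impI)
    fix \<gamma>Q
    assume "solves_euler_lagrange Q' c' (L \<circ> T\<phi>) t0 tf ?Y0 \<gamma>Q"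
    then have \<gamma>Q: "smooth_map (open_mfd S) Q' \<gamma>Q" and in_chart: "\<And>t. t \<in> S \<Longrightarrow> \<gamma>Q t \<in> fst c'"
      and residual: "\<And>t a. t \<in> S \<Longrightarrow> EL_residual (\<Lambda> \<circ> tangent_fun F) (snd \<xi>' (curve_lift Q' \<gamma>Q t))
          (snd (velocity (tangent_bundle Q') (curve_lift Q' \<gamma>Q) t \<xi>')) a = 0"
      and lim: "limitin (mtop (tangent_bundle Q')) (curve_lift Q' \<gamma>Q) ?Y0 (at_right t0)"
      unfolding EL by auto
    note lift = smooth_map_curve_lift[OF Q' S \<gamma>Q]
    have mem: "curve_lift Q' \<gamma>Q t \<in> fst \<xi>'" if "t \<in> S" for t
      using curve_lift_mem_natural_chart[OF Q' S \<gamma>Q that] in_chart[OF that] by blast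
    have "velocity (tangent_bundle Q') (curve_lift Q' \<gamma>Q) t = ?X (curve_lift Q' \<gamma>Q t)" if t: "t \<in> S" for t
      unfolding LMG_ROM_iff_residual[OF mem[OF t] velocity_tangent[OF lift t]]
      using velocity_in_natural_chart(2)[OF S lift t c' mem[OF t]] residual[OF t]
      by (simp add: base_of_curve_lift) (simp add: curve_lift_def)
    then show "solves_LMG_ROM Q' c' Q c \<phi>Q \<rho>Q L \<tau>q t0 tf (q0, v0) (curve_lift Q' \<gamma>Q)"
      unfolding ROM using lift mem lim by blast
  next
    fix \<Gamma>
    assume "solves_LMG_ROM Q' c' Q c \<phi>Q \<rho>Q L \<tau>q t0 tf (q0, v0) \<Gamma>"
    then have \<Gamma>: "smooth_map (open_mfd S) (tangent_bundle Q') \<Gamma>" and mem: "\<And>t. t \<in> S \<Longrightarrow> \<Gamma> t \<in> fst \<xi>'"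
      and ode: "\<And>t. t \<in> S \<Longrightarrow> velocity (tangent_bundle Q') \<Gamma> t = ?X (\<Gamma> t)"
      and lim: "limitin (mtop (tangent_bundle Q')) \<Gamma> ?Y0 (at_right t0)"
      unfolding ROM by auto
    define \<gamma>Q where "\<gamma>Q = fst \<circ> \<Gamma>"
    have \<gamma>Q: "smooth_map (open_mfd S) Q' \<gamma>Q"
      unfolding \<gamma>Q_def by (rule smooth_map_base_curve[OF Q' S \<Gamma>])
    have in_chart: "\<gamma>Q t \<in> fst c'" if "t \<in> S" for t
      using mem[OF that] by (auto simp: \<gamma>Q_def natural_chart_def)
    have weak: "fst (velocity (tangent_bundle Q') \<Gamma> t \<xi>') = snd (\<Gamma> t) c'"
      "EL_residual (\<Lambda> \<circ> tangent_fun F) (snd \<xi>' (\<Gamma> t)) (snd (velocity (tangent_bundle Q') \<Gamma> t \<xi>')) a = 0"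
      if t: "t \<in> S" for t a
      using ode[OF t] LMG_ROM_iff_residual[OF mem[OF t] velocity_tangent[OF \<Gamma> t]] by auto
    \<comment> \<open>The velocity of the base curve is the position part of the velocity of \<open>\<Gamma>\<close>, hence equals the
      velocity coordinate of \<open>\<Gamma>\<close> by the first part of the weak form.\<close>
    have lift: "\<Gamma> t = curve_lift Q' \<gamma>Q t" if t: "t \<in> S" for t
    proof -
      have c't: "c' \<in> charts_at Q' (\<gamma>Q t)"
        using in_chart[OF t] c' by (simp add: charts_at_def)
      have "snd (\<Gamma> t) c' = velocity Q' \<gamma>Q t c'"
        using velocity_in_natural_chart(2)[OF S \<Gamma> t c' mem[OF t]] weak(1)[OF t] by (simp add: \<gamma>Q_def)
      moreover have "snd (\<Gamma> t) \<in> tangent_space Q' (\<gamma>Q t)"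
        using mem[OF t] by (auto simp: \<gamma>Q_def natural_chart_def)
      moreover have "velocity Q' \<gamma>Q t \<in> tangent_space Q' (\<gamma>Q t)"
        by (rule velocity_in_tangent_space[OF Q'.differentiable_atlas_axioms
              smooth_curve_differentiable[OF S charts_openin[OF Q'] \<gamma>Q t]])
      ultimately have "snd (\<Gamma> t) = velocity Q' \<gamma>Q t"
        using Q'.tangent_space_eqI c't by blast
      then show ?thesis
        by (simp add: curve_lift_def \<gamma>Q_def prod_eq_iff)
    qed
    have velocity_lift: "velocity (tangent_bundle Q') (curve_lift Q' \<gamma>Q) t \<xi>'
        = velocity (tangent_bundle Q') \<Gamma> t \<xi>'" if t: "t \<in> S" for t
    proof -
      have "\<forall>\<^sub>F s in nhds t. s \<in> S"
        by (rule eventually_nhds_in_open[OF S t])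
      then have ev: "\<forall>\<^sub>F s in nhds t. (snd \<xi>' \<circ> curve_lift Q' \<gamma>Q) s = (snd \<xi>' \<circ> \<Gamma>) s"
        by (rule eventually_mono) (simp add: lift)
      have "vector_derivative (snd \<xi>' \<circ> curve_lift Q' \<gamma>Q) (at t) = vector_derivative (snd \<xi>' \<circ> \<Gamma>) (at t)"
        by (rule vector_derivative_cong_eq[OF _ refl refl UNIV_I]) (use ev in auto)
      then show ?thesis
        by (simp add: velocity_def lift[OF t])
    qed
    have "\<forall>\<^sub>F t in at_right t0. \<Gamma> t = curve_lift Q' \<gamma>Q t"
      using eventually_at_right_less[of t0] eventually_at_right_real[OF \<open>t0 < tf\<close>]
      by eventually_elim (simp add: lift S_def)
    then have "limitin (mtop (tangent_bundle Q')) (curve_lift Q' \<gamma>Q) ?Y0 (at_right t0)"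
      using lim by (rule limitin_transform_eventually)
    then have "solves_euler_lagrange Q' c' (L \<circ> T\<phi>) t0 tf ?Y0 \<gamma>Q"
      unfolding EL using \<gamma>Q in_chart weak(2) lift velocity_lift by simp
    then show "\<exists>\<gamma>Q. solves_euler_lagrange Q' c' (L \<circ> T\<phi>) t0 tf ?Y0 \<gamma>Q \<and>
        (\<forall>t\<in>{t0<..<tf}. \<Gamma> t = curve_lift Q' \<gamma>Q t)"
      using lift unfolding S_def by blast
  qed
qed

end
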